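(* Let $\Omega\subset\mathbb{H}$ be a circular domain, let $f,g\in\mathcal{SEM}(\Omega)\setminus\mathcal{SEM}_{\mathbb{R}}(\Omega)$ with $f_{0}=-g_{0}$ and $f_{v}^{s}=g_{v}^{s}$, and let $\mathfrak{b}\in\mathcal{SEM}(\Omega)$. Then the equation $f*\chi+\chi*g=\mathfrak{b}$ has a solution $\chi\in\mathcal{SEM}(\Omega)$ if and only if $$f^{c}*\mathfrak{b}+\mathfrak{b}*g\equiv 0.$$
   Context: $\mathbb{H}$ denotes the quaternions, $q^c$ the quaternionic conjugate, $\mathbb{S}=\{q\in\mathbb{H}: q^2=-1\}$, and $\mathbb{C}_I=\mathbb{R}+I\mathbb{R}$ for $I\in\mathbb{S}$. For $q=x+Iy$ put $\mathbb{S}_q=\{x+Jy: J\in\mathbb{S}\}$. A domain (connected open set) $\Omega\subset\mathbb{H}$ is circular if $\mathbb{S}_q\subset\Omega$ for all $q\in\Omega$. A function $f$ on a circular open set $\Omega$ is slice regular ($f\in\mathcal{SR}(\Omega)$) if $f(x+Iy)=F_1(x,y)+IF_2(x,y)$ for all $x+Iy\in\Omega$ ($x,y\in\mathbb{R}$, $I\in\mathbb{S}$), with $\mathbb{H}$-valued $F_1$ even in $y$ and $F_2$ odd in $y$, and each restriction $f|_{\Omega\cap\mathbb{C}_I}$ is real differentiable with $\frac12(\partial_x+I\partial_y)f|_{\Omega\cap\mathbb{C}_I}\equiv0$. The $*$-product is $(f*g)(q)=0$ if $f(q)=0$ and $(f*g)(q)=f(q)\,g(f(q)^{-1}qf(q))$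 otherwise. $f$ is slice preserving if $f(\Omega\cap\mathbb{C}_I)\subset\mathbb{C}_I$ for every $I\in\mathbb{S}$. A function $f$ is slice semi-regular on $\Omega$ ($f\in\mathcal{SEM}(\Omega)$) if there is a circular open $\widetilde\Omega\subseteq\Omega$ with $f\in\mathcal{SR}(\widetilde\Omega)$ and each point of $\Omega\setminus\widetilde\Omega$ is a pole or a removable singularity; i.e. $\Omega\setminus\widetilde\Omega$ consists of isolated real points and isolated spheres $\mathbb{S}_p$, near each of which $\Delta_p^m f$ extends slice regularly for some integer $m\ge0$, where $\Delta_p(q)=q^2-2\mathrm{Re}(p)q+|p|^2$. Functions agreeing where both are defined are identified. $\mathcal{SEM}_{\mathbb{R}}(\Omega)$ is the subset of slice preserving elements; it is a field and the center of the algebra $(\mathcal{SEM}(\Omega),+,* )$, which is a 4-dimensional vector space over it: for an orthonormal basis $(1,I,J,K)$ of $\mathbb{H}$, each $f$ is uniquely $f_0+f_1I+f_2J+f_3K$ with $f_\ell\in\mathcal{SEM}_{\mathbb{R}}(\Omega)$. Set $f^c=f_0-(f_1I+f_2J+f_3K)$, $f^s=f*f^c=f_0^2+f_1^2+f_2^2+f_3^2$, $f_0=(f+f^c)/2$, $f_v=f-f_0$, so $f_v^s=(f_v)^s=f_1^2+f_2^2+f_3^2$. *)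

theory Defs
  imports "HOL-Analysis.Analysis"
begin

section \<open>Quaternions\<close>

datatype quat = Quat (qRe: real) (qIm1: real) (qIm2: real) (qIm3: real)

lemma quat_eq_iff:
  "p = q \<longleftrightarrow> qRe p = qRe q \<and> qIm1 p = qIm1 q \<and> qIm2 p = qIm2 q \<and> qIm3 p = qIm3 q"
  by (cases p; cases q) auto

instantiation quat :: real_vector
begin

definition "0 = Quat 0 0 0 0"
definition "p + q = Quat (qRe p + qRe q) (qIm1 p + qIm1 q) (qIm2 p + qIm2 q) (qIm3 p + qIm3 q)"
definition "p - q = Quat (qRe p - qRe q) (qIm1 p - qIm1 q) (qIm2 p - qIm2 q) (qIm3 p - qIm3 q)"
definition "- q = Quat (- qRe q) (- qIm1 q) (- qIm2 q) (- qIm3 q)"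
definition "r *\<^sub>R q = Quat (r * qRe q) (r * qIm1 q) (r * qIm2 q) (r * qIm3 q)"

instance
  by standard
    (auto simp: quat_eq_iff zero_quat_def plus_quat_def minus_quat_def uminus_quat_def
       scaleR_quat_def algebra_simps)

end

lemma quat_zero_sel [simp]: "qRe 0 = 0" "qIm1 0 = 0" "qIm2 0 = 0" "qIm3 0 = 0"
  by (simp_all add: zero_quat_def)

lemma quat_add_sel [simp]:
  "qRe (p + q) = qRe p + qRe q" "qIm1 (p + q) = qIm1 p + qIm1 q"
  "qIm2 (p + q) = qIm2 p + qIm2 q" "qIm3 (p + q) = qIm3 p + qIm3 q"
  by (simp_all add: plus_quat_def)

lemma quat_diff_sel [simp]:
  "qRe (p - q) = qRe p - qRe q" "qIm1 (p - q) = qIm1 p - qIm1 q"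
  "qIm2 (p - q) = qIm2 p - qIm2 q" "qIm3 (p - q) = qIm3 p - qIm3 q"
  by (simp_all add: minus_quat_def)

lemma quat_uminus_sel [simp]:
  "qRe (- q) = - qRe q" "qIm1 (- q) = - qIm1 q"
  "qIm2 (- q) = - qIm2 q" "qIm3 (- q) = - qIm3 q"
  by (simp_all add: uminus_quat_def)

lemma quat_scaleR_sel [simp]:
  "qRe (r *\<^sub>R q) = r * qRe q" "qIm1 (r *\<^sub>R q) = r * qIm1 q"
  "qIm2 (r *\<^sub>R q) = r * qIm2 q" "qIm3 (r *\<^sub>R q) = r * qIm3 q"
  by (simp_all add: scaleR_quat_def)

instantiation quat :: real_inner
begin

definition "inner p q = qRe p * qRe q + qIm1 p * qIm1 q + qIm2 p * qIm2 q + qIm3 p * qIm3 q"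
definition "norm (q::quat) = sqrt (inner q q)"
definition "sgn (q::quat) = q /\<^sub>R norm q"
definition "dist (p::quat) q = norm (p - q)"
definition "(uniformity :: (quat \<times> quat) filter) = (INF e\<in>{0 <..}. principal {(x, y). dist x y < e})"
definition "open (U::quat set) \<longleftrightarrow> (\<forall>x\<in>U. eventually (\<lambda>(x', y). x' = x \<longrightarrow> y \<in> U) uniformity)"

instance
proof
  fix p q r :: quat and a :: real
  show "inner p q = inner q p"
    by (simp add: inner_quat_def mult.commute)
  show "inner (p + q) r = inner p r + inner q r"
    by (simp add: inner_quat_def algebra_simps)
  show "inner (a *\<^sub>R p) q = a * inner p q"
    by (simp add: inner_quat_def algebra_simps)
  show "0 \<le> inner p p"
    by (simp add: inner_quat_def)
  show "inner p p = 0 \<longleftrightarrow> p = 0"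
    by (auto simp: inner_quat_def quat_eq_iff add_nonneg_eq_0_iff)
qed (fact norm_quat_def sgn_quat_def dist_quat_def uniformity_quat_def open_quat_def)+

end

lemma norm_quat_eq: "norm q = sqrt ((qRe q)\<^sup>2 + (qIm1 q)\<^sup>2 + (qIm2 q)\<^sup>2 + (qIm3 q)\<^sup>2)"
  by (simp add: norm_quat_def inner_quat_def power2_eq_square)

instantiation quat :: real_normed_div_algebra
begin

definition "1 = Quat 1 0 0 0"
definition "p * q = Quat
  (qRe p * qRe q - qIm1 p * qIm1 q - qIm2 p * qIm2 q - qIm3 p * qIm3 q)
  (qRe p * qIm1 q + qIm1 p * qRe q + qIm2 p * qIm3 q - qIm3 p * qIm2 q)
  (qRe p * qIm2 q - qIm1 p * qIm3 q + qIm2 p * qRe q + qIm3 p * qIm1 q)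
  (qRe p * qIm3 q + qIm1 p * qIm2 q - qIm2 p * qIm1 q + qIm3 p * qRe q)"
definition "inverse q = Quat (qRe q) (- qIm1 q) (- qIm2 q) (- qIm3 q) /\<^sub>R (norm q)\<^sup>2"
definition "p div q = p * inverse (q::quat)"

instance
proof
  fix p q r :: quat and a :: real
  show "p * q * r = p * (q * r)" "1 * p = p" "p * 1 = p"
    "(p + q) * r = p * r + q * r" "p * (q + r) = p * q + p * r"
    "a *\<^sub>R p * q = a *\<^sub>R (p * q)" "p * a *\<^sub>R q = a *\<^sub>R (p * q)"
    by (simp_all add: quat_eq_iff times_quat_def one_quat_def algebra_simps)
  show "(0::quat) \<noteq> 1"
    by (simp add: quat_eq_iff one_quat_def)
  have norm2: "(norm q)\<^sup>2 = (qRe q)\<^sup>2 + (qIm1 q)\<^sup>2 + (qIm2 q)\<^sup>2 + (qIm3 q)\<^sup>2" for q :: quat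
    by (simp add: norm_quat_eq)
  let ?c = "Quat (qRe p) (- qIm1 p) (- qIm2 p) (- qIm3 p)"
  have c: "?c * p = (norm p)\<^sup>2 *\<^sub>R 1" "p * ?c = (norm p)\<^sup>2 *\<^sub>R 1"
    by (simp_all add: quat_eq_iff times_quat_def one_quat_def norm2) (simp_all add: power2_eq_square)
  have sc: "a *\<^sub>R p * q = a *\<^sub>R (p * q)" "p * a *\<^sub>R q = a *\<^sub>R (p * q)" for a and p q :: quat
    by (simp_all add: quat_eq_iff times_quat_def algebra_simps)
  show "inverse p * p = 1" "p * inverse p = 1" if "p \<noteq> 0"
    using that by (simp_all add: inverse_quat_def sc c)
  show "p div q = p * inverse q"
    by (fact divide_quat_def)
  show "inverse (0::quat) = 0"
    by (simp add: inverse_quat_def quat_eq_iff)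
  have "(norm (p * q))\<^sup>2 = (norm p * norm q)\<^sup>2"
    unfolding power_mult_distrib norm2 by (simp add: times_quat_def power2_eq_square algebra_simps)
  then show "norm (p * q) = norm p * norm q"
    by (simp add: power2_eq_iff_nonneg)
qed

end

definition quat_i :: quat where "quat_i = Quat 0 1 0 0"
definition quat_j :: quat where "quat_j = Quat 0 0 1 0"
definition quat_k :: quat where "quat_k = Quat 0 0 0 1"

instantiation quat :: euclidean_space
begin

definition "Basis = {1, quat_i, quat_j, quat_k}"

instance
proof
  show "(Basis :: quat set) \<noteq> {}" "finite (Basis :: quat set)"
    by (simp_all add: Basis_quat_def)
  show "inner u v = (if u = v then 1 else 0)" if "u \<in> Basis" "v \<in> Basis" for u v :: quat
    using that unfolding Basis_quat_def quat_i_def quat_j_def quat_k_def one_quat_def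
    by (elim insertE emptyE; simp add: inner_quat_def)
  show "(\<forall>u\<in>Basis. inner x u = 0) \<longleftrightarrow> x = 0" for x :: quat
    unfolding Basis_quat_def quat_i_def quat_j_def quat_k_def one_quat_def
    by (simp add: inner_quat_def quat_eq_iff[of x 0])
qed

end


section \<open>Circular sets and slice regular functions\<close>

definition imag_units :: "quat set" where
  "imag_units = {q. q\<^sup>2 = -1}"

definition slice_plane :: "quat \<Rightarrow> quat set" where
  "slice_plane I = {of_real x + I * of_real y | x y. True}"

text \<open>For a real \<^term>\<open>q\<close> this is the singleton of \<^term>\<open>q\<close>.\<close>
definition quat_sphere :: "quat \<Rightarrow> quat set" where
  "quat_sphere q = {of_real x + J * of_real y | x y I J.
     I \<in> imag_units \<and> J \<in> imag_units \<and> q = of_real x + I * of_real y}"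

definition circular :: "quat set \<Rightarrow> bool" where
  "circular D \<longleftrightarrow> (\<forall>q\<in>D. quat_sphere q \<subseteq> D)"

definition circular_domain :: "quat set \<Rightarrow> bool" where
  "circular_domain D \<longleftrightarrow> open D \<and> connected D \<and> circular D"

definition slice_function_on :: "quat set \<Rightarrow> (quat \<Rightarrow> quat) \<Rightarrow> bool" where
  "slice_function_on D f \<longleftrightarrow> (\<exists>F1 F2 :: real \<Rightarrow> real \<Rightarrow> quat.
     (\<forall>x y. F1 x (- y) = F1 x y) \<and> (\<forall>x y. F2 x (- y) = - F2 x y) \<and>
     (\<forall>x y. \<forall>I\<in>imag_units. of_real x + I * of_real y \<in> D \<longrightarrow>
        f (of_real x + I * of_real y) = F1 x y + I * F2 x y))"

text \<open>\<^term>\<open>L (1, 0)\<close> and \<^term>\<open>L (0, 1)\<close> are the partial derivatives of the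
  restriction of \<^term>\<open>f\<close> to the plane of \<^term>\<open>I\<close>.\<close>
definition slice_regular_on :: "quat set \<Rightarrow> (quat \<Rightarrow> quat) \<Rightarrow> bool" where
  "slice_regular_on D f \<longleftrightarrow> open D \<and> circular D \<and> slice_function_on D f \<and>
     (\<forall>I\<in>imag_units. \<forall>x y. of_real x + I * of_real y \<in> D \<longrightarrow>
        (\<exists>L. ((\<lambda>(u, v). f (of_real u + I * of_real v)) has_derivative L) (at (x, y)) \<and>
             (1/2) *\<^sub>R (L (1, 0) + I * L (0, 1)) = 0))"

definition star_prod :: "(quat \<Rightarrow> quat) \<Rightarrow> (quat \<Rightarrow> quat) \<Rightarrow> quat \<Rightarrow> quat" where
  "star_prod f g q = (if f q = 0 then 0 else f q * g (inverse (f q) * q * f q))"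


section \<open>Slice semi-regular functions\<close>

text \<open>A semi-regular function is a partial function whose domain is the set on which it is
  given as a slice regular function. Functions that agree where both are defined are
  identified: this is the relation \<open>=\<^sub>s\<close>, and it takes the place of equality throughout.\<close>

type_synonym pfun = "quat \<Rightarrow> quat option"

definition sem_eq :: "pfun \<Rightarrow> pfun \<Rightarrow> bool" (infix "=\<^sub>s" 50) where
  "f =\<^sub>s g \<longleftrightarrow> (\<forall>q \<in> dom f \<inter> dom g. f q = g q)"

definition sem_const :: "quat set \<Rightarrow> quat \<Rightarrow> pfun" where
  "sem_const \<Omega> c = (\<lambda>q. if q \<in> \<Omega> then Some c else None)"

definition sem_scale :: "real \<Rightarrow> pfun \<Rightarrow> pfun" where
  "sem_scale r f = (\<lambda>q. map_option ((*\<^sub>R) r) (f q))"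

definition sem_uminus :: "pfun \<Rightarrow> pfun" ("-\<^sub>s _" [81] 80) where
  "-\<^sub>s f = (\<lambda>q. map_option uminus (f q))"

definition sem_add :: "pfun \<Rightarrow> pfun \<Rightarrow> pfun" (infixl "+\<^sub>s" 65) where
  "f +\<^sub>s g = (\<lambda>q. if q \<in> dom f \<inter> dom g then Some (the (f q) + the (g q)) else None)"

definition sem_diff :: "pfun \<Rightarrow> pfun \<Rightarrow> pfun" (infixl "-\<^sub>s" 65) where
  "f -\<^sub>s g = (\<lambda>q. if q \<in> dom f \<inter> dom g then Some (the (f q) - the (g q)) else None)"

text \<open>On circular domains the point at which \<^const>\<open>star_prod\<close> evaluates its second factor
  lies on the sphere of \<^term>\<open>q\<close>, hence again in the domain.\<close>
definition sem_star :: "pfun \<Rightarrow> pfun \<Rightarrow> pfun" (infixl "\<star>" 70) where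
  "f \<star> g = (\<lambda>q. if q \<in> dom f \<inter> dom g
     then Some (star_prod (\<lambda>p. the (f p)) (\<lambda>p. the (g p)) q) else None)"

definition sphere_poly :: "quat \<Rightarrow> quat \<Rightarrow> quat" where
  "sphere_poly p q = q\<^sup>2 - of_real (2 * qRe p) * q + of_real ((norm p)\<^sup>2)"

text \<open>The condition \<^prop>\<open>U - dom f = quat_sphere p\<close> says that the sphere (or real point) of
  \<^term>\<open>p\<close> is isolated in the singular set.\<close>
definition SEM :: "quat set \<Rightarrow> pfun set" where
  "SEM \<Omega> = {f. dom f \<subseteq> \<Omega> \<and> slice_regular_on (dom f) (\<lambda>q. the (f q)) \<and>
     (\<forall>p \<in> \<Omega> - dom f. \<exists>U. open U \<and> circular U \<and> U \<subseteq> \<Omega> \<and> U - dom f = quat_sphere p \<and>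
        (\<exists>(m::nat) h. slice_regular_on U h \<and>
           (\<forall>q \<in> U - quat_sphere p. h q = sphere_poly p q ^ m * the (f q))))}"

definition slice_preserving :: "pfun \<Rightarrow> bool" where
  "slice_preserving f \<longleftrightarrow>
     (\<forall>I\<in>imag_units. \<forall>q \<in> dom f \<inter> slice_plane I. the (f q) \<in> slice_plane I)"

definition SEMR :: "quat set \<Rightarrow> pfun set" where
  "SEMR \<Omega> = {f \<in> SEM \<Omega>. slice_preserving f}"

text \<open>Coordinates over \<^const>\<open>SEMR\<close> are taken with respect to the standard basis of the
  quaternions and are unique only up to \<open>=\<^sub>s\<close>; the conjugate does not depend on the
  orthonormal basis completing \<open>1\<close>, again up to \<open>=\<^sub>s\<close>.\<close>

definition sem_coords :: "quat set \<Rightarrow> pfun \<Rightarrow> pfun \<times> pfun \<times> pfun \<times> pfun \<Rightarrow> bool" where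
  "sem_coords \<Omega> f = (\<lambda>(f0, f1, f2, f3).
     f0 \<in> SEMR \<Omega> \<and> f1 \<in> SEMR \<Omega> \<and> f2 \<in> SEMR \<Omega> \<and> f3 \<in> SEMR \<Omega> \<and>
     f =\<^sub>s f0 +\<^sub>s (f1 \<star> sem_const \<Omega> quat_i +\<^sub>s f2 \<star> sem_const \<Omega> quat_j +\<^sub>s f3 \<star> sem_const \<Omega> quat_k))"

definition sem_conj :: "quat set \<Rightarrow> pfun \<Rightarrow> pfun" where
  "sem_conj \<Omega> f = (case (SOME c. sem_coords \<Omega> f c) of (f0, f1, f2, f3) \<Rightarrow>
     f0 -\<^sub>s (f1 \<star> sem_const \<Omega> quat_i +\<^sub>s f2 \<star> sem_const \<Omega> quat_j +\<^sub>s f3 \<star> sem_const \<Omega> quat_k))"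

definition sem_symm :: "quat set \<Rightarrow> pfun \<Rightarrow> pfun" where
  "sem_symm \<Omega> f = f \<star> sem_conj \<Omega> f"

definition sem_re :: "quat set \<Rightarrow> pfun \<Rightarrow> pfun" where
  "sem_re \<Omega> f = sem_scale (1/2) (f +\<^sub>s sem_conj \<Omega> f)"

definition sem_vec :: "quat set \<Rightarrow> pfun \<Rightarrow> pfun" where
  "sem_vec \<Omega> f = f -\<^sub>s sem_re \<Omega> f"

end

theory Submission
  imports Defs "HOL-Complex_Analysis.Complex_Analysis"
begin

text \<open>A slice function \<open>f (x + I y) = F\<^sub>1 (x, y) + I F\<^sub>2 (x, y)\<close> is encoded by its stem
\<open>F = F\<^sub>1 + \<iota> F\<^sub>2\<close>, a function of \<open>z = x + \<i> y\<close> with values in the quaternions with complex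
coefficients that satisfies \<open>F (cnj z) = cnj (F z)\<close>. In this encoding slice regularity is
holomorphy of the four complex coordinates of \<open>F\<close>, and the star product is the pointwise
product of stems (\<open>star_prod_slice_val\<close>). A semi-regular function has a stem with meromorphic
coordinates, and conversely such a stem, holomorphic off isolated points, induces a semi-regular
function (\<open>SEM_meromorphic_stem\<close>, \<open>induced_pfun_SEM\<close>). The relation \<open>=\<^sub>s\<close> becomes equality of
stems off isolated points (\<open>sem_eq_iff_stem\<close>). Hence both sides of the equivalence turn into
identities in the algebra of complex quaternions.

In that algebra let \<open>f = f\<^sub>0 + f\<^sub>v\<close> and \<open>g = - f\<^sub>0 + g\<^sub>v\<close>, with \<open>f\<^sub>0\<close> central. Then \<open>g\<close> is a
root of its own characteristic polynomial, which by hypothesis is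
\<open>t\<^sup>2 + 2 f\<^sub>0 t + f\<^sup>c f\<close>, and expanding \<open>f\<^sup>c (f \<chi> + \<chi> g) + (f \<chi> + \<chi> g) g\<close> gives \<open>\<chi>\<close> times that
polynomial at \<open>g\<close>. So the condition is necessary (\<open>sylvester_necessary\<close>).

For sufficiency, the equation reads \<open>f\<^sub>v \<chi> + \<chi> g\<^sub>v = b\<close> and the condition reads
\<open>f\<^sub>v b = b g\<^sub>v\<close>. If \<open>f\<^sub>v u + u f\<^sub>v = 1\<close>, then \<open>\<chi> = u b\<close> is a solution, because
\<open>f\<^sub>v u b + u b g\<^sub>v = (f\<^sub>v u + u f\<^sub>v) b\<close> (\<open>sylvester_sufficient\<close>). Such a \<open>u\<close> exists even
when \<open>f\<^sub>v\<close> is a zero divisor, which can happen if the domain misses the real axis: as \<open>f\<close> is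
not slice preserving, one of its coordinates with respect to \<open>i, j, k\<close> is not identically
zero, and if \<open>\<phi>\<close> is this coordinate and \<open>e\<close> the corresponding unit, then
\<open>f\<^sub>v e + e f\<^sub>v = - 2 \<phi>\<close>, so that \<open>u = - (2 \<phi>)\<^sup>-\<^sup>1 e\<close> works. It is semi-regular because the
zeros of \<open>\<phi>\<close> are isolated, by connectedness of the domain (\<open>meromorphic_zero_dichotomy\<close>).\<close>

section \<open>Complex quaternions\<close>

text \<open>The tensor product of the quaternions with the complex numbers. The complex scalars are central
here, unlike the imaginary unit \<open>i\<close> inside the quaternions.\<close>

datatype biquat = Biquat (bq0: complex) (bq1: complex) (bq2: complex) (bq3: complex)

lemma biquat_eq_iff:
  "a = b \<longleftrightarrow> bq0 a = bq0 b \<and> bq1 a = bq1 b \<and> bq2 a = bq2 b \<and> bq3 a = bq3 b"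
  by (cases a; cases b) auto

instantiation biquat :: ring_1
begin

definition "0 = Biquat 0 0 0 0"
definition "1 = Biquat 1 0 0 0"
definition "a + b = Biquat (bq0 a + bq0 b) (bq1 a + bq1 b) (bq2 a + bq2 b) (bq3 a + bq3 b)"
definition "a - b = Biquat (bq0 a - bq0 b) (bq1 a - bq1 b) (bq2 a - bq2 b) (bq3 a - bq3 b)"
definition "- a = Biquat (- bq0 a) (- bq1 a) (- bq2 a) (- bq3 a)"
definition "a * b = Biquat
  (bq0 a * bq0 b - bq1 a * bq1 b - bq2 a * bq2 b - bq3 a * bq3 b)
  (bq0 a * bq1 b + bq1 a * bq0 b + bq2 a * bq3 b - bq3 a * bq2 b)
  (bq0 a * bq2 b - bq1 a * bq3 b + bq2 a * bq0 b + bq3 a * bq1 b)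
  (bq0 a * bq3 b + bq1 a * bq2 b - bq2 a * bq1 b + bq3 a * bq0 b)"

instance
  by standard
    (simp_all add: biquat_eq_iff zero_biquat_def one_biquat_def plus_biquat_def minus_biquat_def
      uminus_biquat_def times_biquat_def algebra_simps)

end

lemma biquat_sel [simp]:
  "bq0 0 = 0" "bq1 0 = 0" "bq2 0 = 0" "bq3 0 = 0"
  "bq0 1 = 1" "bq1 1 = 0" "bq2 1 = 0" "bq3 1 = 0"
  "bq0 (a + b) = bq0 a + bq0 b" "bq1 (a + b) = bq1 a + bq1 b"
  "bq2 (a + b) = bq2 a + bq2 b" "bq3 (a + b) = bq3 a + bq3 b"
  "bq0 (a - b) = bq0 a - bq0 b" "bq1 (a - b) = bq1 a - bq1 b"
  "bq2 (a - b) = bq2 a - bq2 b" "bq3 (a - b) = bq3 a - bq3 b"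
  "bq0 (- a) = - bq0 a" "bq1 (- a) = - bq1 a" "bq2 (- a) = - bq2 a" "bq3 (- a) = - bq3 a"
  by (simp_all add: zero_biquat_def one_biquat_def plus_biquat_def minus_biquat_def
      uminus_biquat_def)

lemma biquat_times_sel:
  "bq0 (a * b) = bq0 a * bq0 b - bq1 a * bq1 b - bq2 a * bq2 b - bq3 a * bq3 b"
  "bq1 (a * b) = bq0 a * bq1 b + bq1 a * bq0 b + bq2 a * bq3 b - bq3 a * bq2 b"
  "bq2 (a * b) = bq0 a * bq2 b - bq1 a * bq3 b + bq2 a * bq0 b + bq3 a * bq1 b"
  "bq3 (a * b) = bq0 a * bq3 b + bq1 a * bq2 b - bq2 a * bq1 b + bq3 a * bq0 b"
  by (simp_all add: times_biquat_def)

definition bscal :: "complex \<Rightarrow> biquat" where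
  "bscal c = Biquat c 0 0 0"

definition bconj :: "biquat \<Rightarrow> biquat" where
  "bconj a = Biquat (bq0 a) (- bq1 a) (- bq2 a) (- bq3 a)"

definition bvec :: "biquat \<Rightarrow> biquat" where
  "bvec a = Biquat 0 (bq1 a) (bq2 a) (bq3 a)"

text \<open>The conjugation of the complex scalars, an automorphism; \<open>bconj\<close> is the quaternionic one, an
antiautomorphism that is linear over the complex scalars.\<close>

definition bcnj :: "biquat \<Rightarrow> biquat" where
  "bcnj a = Biquat (cnj (bq0 a)) (cnj (bq1 a)) (cnj (bq2 a)) (cnj (bq3 a))"

definition bquat :: "quat \<Rightarrow> biquat" where
  "bquat p = Biquat (of_real (qRe p)) (of_real (qIm1 p)) (of_real (qIm2 p)) (of_real (qIm3 p))"

lemma bscal_sel [simp]: "bq0 (bscal c) = c" "bq1 (bscal c) = 0" "bq2 (bscal c) = 0" "bq3 (bscal c) = 0"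
  by (simp_all add: bscal_def)

lemma bconj_sel [simp]: "bq0 (bconj a) = bq0 a" "bq1 (bconj a) = - bq1 a"
  "bq2 (bconj a) = - bq2 a" "bq3 (bconj a) = - bq3 a"
  by (simp_all add: bconj_def)

lemma bvec_sel [simp]: "bq0 (bvec a) = 0" "bq1 (bvec a) = bq1 a" "bq2 (bvec a) = bq2 a"
  "bq3 (bvec a) = bq3 a"
  by (simp_all add: bvec_def)

lemma bcnj_sel [simp]: "bq0 (bcnj a) = cnj (bq0 a)" "bq1 (bcnj a) = cnj (bq1 a)"
  "bq2 (bcnj a) = cnj (bq2 a)" "bq3 (bcnj a) = cnj (bq3 a)"
  by (simp_all add: bcnj_def)

lemma bquat_sel [simp]: "bq0 (bquat p) = of_real (qRe p)" "bq1 (bquat p) = of_real (qIm1 p)"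
  "bq2 (bquat p) = of_real (qIm2 p)" "bq3 (bquat p) = of_real (qIm3 p)"
  by (simp_all add: bquat_def)

lemma bscal_central: "bscal c * a = a * bscal c"
  by (simp add: biquat_eq_iff biquat_times_sel mult.commute)

lemma bscal_mult: "bscal c * bscal d = bscal (c * d)"
  by (simp add: biquat_eq_iff biquat_times_sel)

lemma bcnj_simps [simp]:
  "bcnj (a + b) = bcnj a + bcnj b" "bcnj (a - b) = bcnj a - bcnj b"
  "bcnj (a * b) = bcnj a * bcnj b" "bcnj (- a) = - bcnj a"
  "bcnj (bcnj a) = a" "bcnj (bscal c) = bscal (cnj c)" "bcnj (bquat p) = bquat p"
  "bcnj 0 = 0"
  by (simp_all add: biquat_eq_iff biquat_times_sel)


section \<open>Spheres, circular sets and their traces in the complex plane\<close>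

lemma quat_one_sel [simp]: "qRe 1 = 1" "qIm1 1 = 0" "qIm2 1 = 0" "qIm3 1 = 0"
  by (simp_all add: one_quat_def)

lemma quat_of_real_sel [simp]:
  "qRe (of_real r) = r" "qIm1 (of_real r) = 0" "qIm2 (of_real r) = 0" "qIm3 (of_real r) = 0"
  by (simp_all add: of_real_def)

lemma quat_times_sel:
  "qRe (p * q) = qRe p * qRe q - qIm1 p * qIm1 q - qIm2 p * qIm2 q - qIm3 p * qIm3 q"
  "qIm1 (p * q) = qRe p * qIm1 q + qIm1 p * qRe q + qIm2 p * qIm3 q - qIm3 p * qIm2 q"
  "qIm2 (p * q) = qRe p * qIm2 q - qIm1 p * qIm3 q + qIm2 p * qRe q + qIm3 p * qIm1 q"
  "qIm3 (p * q) = qRe p * qIm3 q + qIm1 p * qIm2 q - qIm2 p * qIm1 q + qIm3 p * qRe q"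
  by (simp_all add: times_quat_def)

lemma of_real_quat_central: "of_real r * q = q * (of_real r :: quat)"
  by (simp add: quat_eq_iff quat_times_sel)

lemma imag_units_iff:
  "I \<in> imag_units \<longleftrightarrow> qRe I = 0 \<and> (qIm1 I)\<^sup>2 + (qIm2 I)\<^sup>2 + (qIm3 I)\<^sup>2 = 1"
proof
  assume "I \<in> imag_units"
  then have *: "I * I = -1"
    by (simp add: imag_units_def power2_eq_square)
  have c: "qRe I * qIm1 I = 0" "qRe I * qIm2 I = 0" "qRe I * qIm3 I = 0"
    "qRe I * qRe I - qIm1 I * qIm1 I - qIm2 I * qIm2 I - qIm3 I * qIm3 I = -1"
    using * by (auto simp: quat_eq_iff quat_times_sel)
  have "qRe I = 0"
  proof (rule ccontr)
    assume "qRe I \<noteq> 0"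
    then have "qRe I * qRe I = -1"
      using c by simp
    then show False
      by (metis not_square_less_zero neg_less_0_iff_less zero_less_one)
  qed
  then show "qRe I = 0 \<and> (qIm1 I)\<^sup>2 + (qIm2 I)\<^sup>2 + (qIm3 I)\<^sup>2 = 1"
    using c(4) by (simp add: power2_eq_square)
qed (simp add: imag_units_def quat_eq_iff quat_times_sel power2_eq_square)

lemma imag_units_sq: "I \<in> imag_units \<Longrightarrow> I * I = -1"
  by (simp add: imag_units_def power2_eq_square)

lemma imag_units_sq_assoc: "I \<in> imag_units \<Longrightarrow> I * (I * a) = - a"
  by (metis imag_units_sq mult.assoc mult_minus_left mult_1)

lemma imag_units_uminus: "I \<in> imag_units \<Longrightarrow> - I \<in> imag_units"
  by (simp add: imag_units_def)

lemma quat_i_imag_unit [simp]: "quat_i \<in> imag_units"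
  by (simp add: imag_units_iff quat_i_def)

text \<open>The next two maps relate a sphere to its parameter: \<open>slice_pt I z\<close> is the point of the plane of
\<open>I\<close> with parameter \<open>z\<close>, and \<open>half_plane_pt\<close> picks, of the two conjugate parameters of a point,
the one in the closed upper half plane. The fibres of the latter are exactly the spheres, which
makes preimages under it circular.\<close>

definition slice_pt :: "quat \<Rightarrow> complex \<Rightarrow> quat" where
  "slice_pt I z = of_real (Re z) + I * of_real (Im z)"

definition half_plane_pt :: "quat \<Rightarrow> complex" where
  "half_plane_pt q = Complex (qRe q) (sqrt ((qIm1 q)\<^sup>2 + (qIm2 q)\<^sup>2 + (qIm3 q)\<^sup>2))"

lemma half_plane_pt_slice_pt:
  assumes "I \<in> imag_units"
  shows "half_plane_pt (slice_pt I z) = Complex (Re z) \<bar>Im z\<bar>"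
proof -
  have "(qIm1 I * Im z)\<^sup>2 + (qIm2 I * Im z)\<^sup>2 + (qIm3 I * Im z)\<^sup>2
      = ((qIm1 I)\<^sup>2 + (qIm2 I)\<^sup>2 + (qIm3 I)\<^sup>2) * (Im z)\<^sup>2"
    by (simp add: power_mult_distrib algebra_simps)
  also have "\<dots> = (Im z)\<^sup>2"
    using assms by (simp add: imag_units_iff)
  finally show ?thesis
    using assms by (simp add: half_plane_pt_def slice_pt_def quat_times_sel imag_units_iff)
qed

lemma slice_pt_half_plane_pt:
  obtains I where "I \<in> imag_units" "slice_pt I (half_plane_pt q) = q"
proof -
  define r where "r = sqrt ((qIm1 q)\<^sup>2 + (qIm2 q)\<^sup>2 + (qIm3 q)\<^sup>2)"
  have r2: "r\<^sup>2 = (qIm1 q)\<^sup>2 + (qIm2 q)\<^sup>2 + (qIm3 q)\<^sup>2"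
    by (simp add: r_def)
  show ?thesis
  proof (cases "r = 0")
    case True
    then have "qIm1 q = 0" "qIm2 q = 0" "qIm3 q = 0"
      using r2 by (simp_all add: add_nonneg_eq_0_iff)
    then have "slice_pt quat_i (half_plane_pt q) = q"
      by (simp add: slice_pt_def half_plane_pt_def quat_eq_iff quat_times_sel)
    then show ?thesis
      using that quat_i_imag_unit by blast
  next
    case False
    define I where "I = Quat 0 (qIm1 q / r) (qIm2 q / r) (qIm3 q / r)"
    have "I \<in> imag_units"
      using False r2 by (simp add: I_def imag_units_iff power_divide flip: add_divide_distrib r2)
    moreover have "slice_pt I (half_plane_pt q) = q"
      using False
      by (simp add: I_def slice_pt_def half_plane_pt_def quat_eq_iff quat_times_sel flip: r_def)
    ultimately show ?thesis
      using that by blast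
  qed
qed

lemma half_plane_pt_cases: "Complex (Re z) \<bar>Im z\<bar> = z \<or> Complex (Re z) \<bar>Im z\<bar> = cnj z"
  by (cases "Im z \<ge> 0") (auto simp: complex_eq_iff)

lemma slice_pt_cnj: "slice_pt I (cnj z) = slice_pt (- I) z"
  by (simp add: slice_pt_def)

lemma quat_sphere_slice_pt:
  assumes "I \<in> imag_units"
  shows "quat_sphere (slice_pt I z) = {slice_pt J z | J. J \<in> imag_units}"
proof (intro equalityI subsetI)
  fix q assume "q \<in> quat_sphere (slice_pt I z)"
  then obtain x y I' J where *: "q = of_real x + J * of_real y" "I' \<in> imag_units" "J \<in> imag_units"
    "slice_pt I z = of_real x + I' * of_real y"
    unfolding quat_sphere_def by auto
  have "slice_pt I z = slice_pt I' (Complex x y)"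
    using * by (simp add: slice_pt_def)
  then have "half_plane_pt (slice_pt I z) = half_plane_pt (slice_pt I' (Complex x y))"
    by simp
  then have "x = Re z" "\<bar>y\<bar> = \<bar>Im z\<bar>"
    using half_plane_pt_slice_pt assms *(2) by auto
  then have "q = slice_pt J z \<or> q = slice_pt (- J) z"
    using *(1) by (auto simp: slice_pt_def abs_eq_iff)
  then show "q \<in> {slice_pt J z | J. J \<in> imag_units}"
    using *(3) imag_units_uminus by blast
next
  fix q assume "q \<in> {slice_pt J z | J. J \<in> imag_units}"
  then show "q \<in> quat_sphere (slice_pt I z)"
    using assms unfolding quat_sphere_def slice_pt_def by blast
qed

text \<open>For circular \<open>A\<close> every imaginary unit in place of \<open>i\<close> gives the same set.\<close>

definition slice_dom :: "quat set \<Rightarrow> complex set" where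
  "slice_dom A = {z. slice_pt quat_i z \<in> A}"

lemma slice_dom_Int: "slice_dom (A \<inter> B) = slice_dom A \<inter> slice_dom B"
  by (auto simp: slice_dom_def)

lemma circular_slice_pt_iff:
  assumes "circular A" "I \<in> imag_units"
  shows "slice_pt I z \<in> A \<longleftrightarrow> z \<in> slice_dom A"
proof -
  have "slice_pt J z \<in> A" if "slice_pt I z \<in> A" "I \<in> imag_units" "J \<in> imag_units" for I J
    using assms(1) that quat_sphere_slice_pt[OF that(2), of z] unfolding circular_def by blast
  then show ?thesis
    using assms(2) quat_i_imag_unit unfolding slice_dom_def by blast
qed

lemma slice_dom_cnj:
  assumes "circular A"
  shows "cnj z \<in> slice_dom A \<longleftrightarrow> z \<in> slice_dom A"
  using circular_slice_pt_iff[OF assms, of "- quat_i" z]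
  by (simp add: imag_units_uminus slice_dom_def slice_pt_cnj)

lemma circular_mem_iff:
  assumes "circular A"
  shows "q \<in> A \<longleftrightarrow> half_plane_pt q \<in> slice_dom A"
  using slice_pt_half_plane_pt[of q] circular_slice_pt_iff[OF assms] by metis

lemma slice_dom_half_plane_iff:
  assumes "circular A"
  shows "Complex (Re z) \<bar>Im z\<bar> \<in> slice_dom A \<longleftrightarrow> z \<in> slice_dom A"
  using half_plane_pt_cases[of z] slice_dom_cnj[OF assms] by metis

lemma circular_vimage_half_plane_pt: "circular (half_plane_pt -` B)"
proof -
  have "q' \<in> half_plane_pt -` B" if q: "q \<in> half_plane_pt -` B" and q': "q' \<in> quat_sphere q" for q q'
  proof -
    obtain I where I: "I \<in> imag_units" "slice_pt I (half_plane_pt q) = q"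
      using slice_pt_half_plane_pt .
    then obtain J where J: "J \<in> imag_units" "q' = slice_pt J (half_plane_pt q)"
      using q' quat_sphere_slice_pt[OF I(1), of "half_plane_pt q"] by auto
    have "half_plane_pt q' = half_plane_pt q"
      using half_plane_pt_slice_pt[OF I(1)] half_plane_pt_slice_pt[OF J(1)] I(2) J(2) by metis
    then show ?thesis
      using q by simp
  qed
  then show ?thesis
    unfolding circular_def by blast
qed

lemma circular_Int: "circular A \<Longrightarrow> circular B \<Longrightarrow> circular (A \<inter> B)"
  unfolding circular_def by blast

lemma quat_sphere_eq_vimage: "quat_sphere p = half_plane_pt -` {half_plane_pt p}"
proof -
  obtain I where I: "I \<in> imag_units" "slice_pt I (half_plane_pt p) = p"
    using slice_pt_half_plane_pt .
  have s: "quat_sphere p = {slice_pt J (half_plane_pt p) | J. J \<in> imag_units}"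
    using quat_sphere_slice_pt[OF I(1)] I(2) by metis
  have nn: "Im (half_plane_pt p) \<ge> 0"
    by (simp add: half_plane_pt_def)
  show ?thesis
  proof (intro equalityI subsetI)
    fix q assume "q \<in> quat_sphere p"
    then show "q \<in> half_plane_pt -` {half_plane_pt p}"
      using s nn half_plane_pt_slice_pt by (auto simp: complex_eq_iff)
  next
    fix q assume "q \<in> half_plane_pt -` {half_plane_pt p}"
    then have "half_plane_pt q = half_plane_pt p"
      by simp
    then show "q \<in> quat_sphere p"
      using s slice_pt_half_plane_pt[of q] by (metis (mono_tags, lifting) mem_Collect_eq)
  qed
qed

lemma continuous_on_qsel [continuous_intros]:
  assumes "continuous_on A f"
  shows "continuous_on A (\<lambda>x. qRe (f x))" "continuous_on A (\<lambda>x. qIm1 (f x))"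
    "continuous_on A (\<lambda>x. qIm2 (f x))" "continuous_on A (\<lambda>x. qIm3 (f x))"
proof -
  have *: "qRe q = inner q 1" "qIm1 q = inner q quat_i" "qIm2 q = inner q quat_j"
    "qIm3 q = inner q quat_k" for q
    by (simp_all add: inner_quat_def quat_i_def quat_j_def quat_k_def)
  show "continuous_on A (\<lambda>x. qRe (f x))" "continuous_on A (\<lambda>x. qIm1 (f x))"
    "continuous_on A (\<lambda>x. qIm2 (f x))" "continuous_on A (\<lambda>x. qIm3 (f x))"
    unfolding * by (intro continuous_intros assms)+
qed

lemma continuous_half_plane_pt: "continuous_on UNIV half_plane_pt"
  unfolding half_plane_pt_def Complex_eq by (intro continuous_intros)

lemma open_vimage_half_plane_pt: "open B \<Longrightarrow> open (half_plane_pt -` B)"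
  using continuous_half_plane_pt open_vimage by blast

lemma open_slice_dom:
  assumes "open A"
  shows "open (slice_dom A)"
proof -
  have "continuous_on UNIV (slice_pt quat_i)"
    unfolding slice_pt_def by (intro continuous_intros)
  then have "open (slice_pt quat_i -` A)"
    using assms open_vimage by blast
  then show ?thesis
    by (simp add: slice_dom_def vimage_def)
qed


section \<open>Values of a complex quaternion on a sphere\<close>

definition re_quat :: "biquat \<Rightarrow> quat" where
  "re_quat a = Quat (Re (bq0 a)) (Re (bq1 a)) (Re (bq2 a)) (Re (bq3 a))"

definition im_quat :: "biquat \<Rightarrow> quat" where
  "im_quat a = Quat (Im (bq0 a)) (Im (bq1 a)) (Im (bq2 a)) (Im (bq3 a))"

lemma re_im_quat_sel [simp]:
  "qRe (re_quat a) = Re (bq0 a)" "qIm1 (re_quat a) = Re (bq1 a)"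
  "qIm2 (re_quat a) = Re (bq2 a)" "qIm3 (re_quat a) = Re (bq3 a)"
  "qRe (im_quat a) = Im (bq0 a)" "qIm1 (im_quat a) = Im (bq1 a)"
  "qIm2 (im_quat a) = Im (bq2 a)" "qIm3 (im_quat a) = Im (bq3 a)"
  by (simp_all add: re_quat_def im_quat_def)

lemma biquat_eq_re_im: "a = b \<longleftrightarrow> re_quat a = re_quat b \<and> im_quat a = im_quat b"
  by (auto simp: biquat_eq_iff quat_eq_iff complex_eq_iff)

lemma re_im_quat_simps:
  "re_quat (a + b) = re_quat a + re_quat b" "im_quat (a + b) = im_quat a + im_quat b"
  "re_quat (a - b) = re_quat a - re_quat b" "im_quat (a - b) = im_quat a - im_quat b"
  "re_quat (- a) = - re_quat a" "im_quat (- a) = - im_quat a"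
  "re_quat (a * b) = re_quat a * re_quat b - im_quat a * im_quat b"
  "im_quat (a * b) = re_quat a * im_quat b + im_quat a * re_quat b"
  "re_quat (bquat p) = p" "im_quat (bquat p) = 0"
  "re_quat (bcnj a) = re_quat a" "im_quat (bcnj a) = - im_quat a"
  by (simp_all add: quat_eq_iff quat_times_sel biquat_times_sel algebra_simps)

definition slice_val :: "quat \<Rightarrow> biquat \<Rightarrow> quat" where
  "slice_val I a = re_quat a + I * im_quat a"

lemma slice_val_simps:
  "slice_val I (a + b) = slice_val I a + slice_val I b"
  "slice_val I (a - b) = slice_val I a - slice_val I b"
  "slice_val I (- a) = - slice_val I a"
  "slice_val I (bquat p) = p"
  "slice_val (- I) (bcnj a) = slice_val I a"
  by (simp_all add: slice_val_def re_im_quat_simps algebra_simps)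

lemma slice_val_bscal: "slice_val I (bscal c) = slice_pt I c"
proof -
  have "re_quat (bscal c) = of_real (Re c)" "im_quat (bscal c) = of_real (Im c)"
    by (simp_all add: quat_eq_iff)
  then show ?thesis
    by (simp add: slice_val_def slice_pt_def)
qed

lemma slice_val_mult:
  assumes "I \<in> imag_units"
  shows "slice_val I (a * b) = slice_val I a * re_quat b + I * slice_val I a * im_quat b"
  using imag_units_sq_assoc[OF assms]
  by (simp add: slice_val_def re_im_quat_simps algebra_simps)

lemma slice_val_inj:
  assumes "I \<in> imag_units" "slice_val I a = slice_val I b" "slice_val (- I) a = slice_val (- I) b"
  shows "a = b"
proof -
  have "slice_val I c + slice_val (- I) c = re_quat c + re_quat c" for c
    by (simp add: slice_val_def)
  then have "re_quat a + re_quat a = re_quat b + re_quat b"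
    using assms(2,3) by metis
  then have r: "re_quat a = re_quat b"
    by (simp add: quat_eq_iff)
  then have "I * im_quat a = I * im_quat b"
    using assms(2) by (simp add: slice_val_def)
  moreover have "I \<noteq> 0"
    using assms(1) by (auto simp: imag_units_iff)
  ultimately show ?thesis
    using r by (simp add: biquat_eq_re_im)
qed

text \<open>Put \<open>p = A q\<close>. If \<open>p \<noteq> 0\<close>, the second factor is evaluated at \<open>p\<^sup>-\<^sup>1 q p\<close>, the point with the same
parameter in the plane of \<open>J = p\<^sup>-\<^sup>1 I p\<close>, and \<open>p J = I p\<close> moves the unit back to the left of
\<open>p\<close>, which is what the product of complex quaternions does. If \<open>p = 0\<close>, both sides vanish.\<close>

lemma star_prod_slice_val:
  assumes I: "I \<in> imag_units" and A: "A (slice_pt I z) = slice_val I a"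
    and B: "\<And>J. J \<in> imag_units \<Longrightarrow> B (slice_pt J z) = slice_val J b"
  shows "star_prod A B (slice_pt I z) = slice_val I (a * b)"
proof (cases "slice_val I a = 0")
  case True
  then show ?thesis
    by (simp add: star_prod_def A slice_val_mult[OF I])
next
  case False
  define p where "p = slice_val I a"
  define J where "J = inverse p * I * p"
  have p: "p \<noteq> 0"
    using False by (simp add: p_def)
  have pJ: "p * J = I * p"
    using p by (simp add: J_def flip: mult.assoc)
  have "J * J = inverse p * I * (p * J)"
    by (simp add: J_def mult.assoc)
  also have "\<dots> = inverse p * (I * I) * p"
    by (simp add: pJ mult.assoc)
  finally have "J \<in> imag_units"
    using p I by (simp add: imag_units_def power2_eq_square)
  moreover have "inverse p * slice_pt I z * p = slice_pt J z"
  proof -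
    have "inverse p * slice_pt I z * p
        = inverse p * (of_real (Re z) * p) + inverse p * I * (of_real (Im z) * p)"
      by (simp add: slice_pt_def algebra_simps)
    also have "\<dots> = inverse p * p * of_real (Re z) + inverse p * I * p * of_real (Im z)"
      unfolding of_real_quat_central[of _ p] by (simp add: mult.assoc)
    finally show ?thesis
      using p by (simp add: J_def slice_pt_def)
  qed
  ultimately have "star_prod A B (slice_pt I z) = p * (re_quat b + J * im_quat b)"
    using p B[of J] by (simp add: star_prod_def A p_def[symmetric] slice_val_def[of J])
  also have "\<dots> = slice_val I (a * b)"
    using pJ by (simp add: slice_val_mult[OF I] p_def[symmetric] distrib_left flip: mult.assoc)
  finally show ?thesis .
qed


section \<open>Slice regularity as holomorphy of the stem\<close>

text \<open>A stem is recovered from the values at the two points of one slice plane on the given sphere: half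
their sum and \<open>- i / 2\<close> times their difference are its real and imaginary part.\<close>

definition of_re_im :: "quat \<Rightarrow> quat \<Rightarrow> biquat" where
  "of_re_im r s = Biquat (Complex (qRe r) (qRe s)) (Complex (qIm1 r) (qIm1 s))
     (Complex (qIm2 r) (qIm2 s)) (Complex (qIm3 r) (qIm3 s))"

lemma re_im_of_re_im [simp]: "re_quat (of_re_im r s) = r" "im_quat (of_re_im r s) = s"
  by (simp_all add: of_re_im_def quat_eq_iff)

definition stem_of :: "(quat \<Rightarrow> quat) \<Rightarrow> complex \<Rightarrow> biquat" where
  "stem_of h z = of_re_im ((1/2) *\<^sub>R (h (slice_pt quat_i z) + h (slice_pt (- quat_i) z)))
     ((- 1/2) *\<^sub>R (quat_i * (h (slice_pt quat_i z) - h (slice_pt (- quat_i) z))))"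

definition symmetric_stem :: "(complex \<Rightarrow> biquat) \<Rightarrow> bool" where
  "symmetric_stem S \<longleftrightarrow> (\<forall>z. S (cnj z) = bcnj (S z))"

lemma symmetric_stem_of: "symmetric_stem (stem_of h)"
  unfolding symmetric_stem_def biquat_eq_re_im
  by (simp add: stem_of_def slice_pt_cnj re_im_quat_simps add.commute algebra_simps)

lemma slice_function_on_stem_of:
  assumes "slice_function_on D h" "circular D" "z \<in> slice_dom D" "I \<in> imag_units"
  shows "h (slice_pt I z) = slice_val I (stem_of h z)"
proof -
  obtain F1 F2 where F: "\<forall>x y. \<forall>I\<in>imag_units. of_real x + I * of_real y \<in> D \<longrightarrow>
      h (of_real x + I * of_real y) = F1 x y + I * F2 x y"
    using assms(1) unfolding slice_function_on_def by blast
  have v: "h (slice_pt J z) = F1 (Re z) (Im z) + J * F2 (Re z) (Im z)" if "J \<in> imag_units" for J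
    using F that circular_slice_pt_iff[OF assms(2) that, of z] assms(3) by (simp add: slice_pt_def)
  have "stem_of h z = of_re_im (F1 (Re z) (Im z)) (F2 (Re z) (Im z))"
    unfolding stem_of_def v[OF quat_i_imag_unit] v[OF imag_units_uminus[OF quat_i_imag_unit]]
      biquat_eq_re_im re_im_of_re_im
    by (simp add: quat_eq_iff quat_times_sel quat_i_def)
  then show ?thesis
    using v[OF assms(4)] by (simp add: slice_val_def)
qed

definition holomorphic_stem :: "(complex \<Rightarrow> biquat) \<Rightarrow> complex set \<Rightarrow> bool" where
  "holomorphic_stem S A \<longleftrightarrow> (\<lambda>z. bq0 (S z)) holomorphic_on A \<and> (\<lambda>z. bq1 (S z)) holomorphic_on A
     \<and> (\<lambda>z. bq2 (S z)) holomorphic_on A \<and> (\<lambda>z. bq3 (S z)) holomorphic_on A"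

text \<open>Multiplying the Cauchy-Riemann equation by \<open>I\<close> shows that the derivative in the direction \<open>y\<close> is
\<open>I\<close> times the derivative \<open>l\<close> in the direction \<open>x\<close>, so the differential is determined by \<open>l\<close>.\<close>

lemma slice_regular_on_imp_derivative:
  assumes "slice_regular_on D h" "z \<in> slice_dom D" "I \<in> imag_units"
  obtains l where "((\<lambda>w. h (slice_pt I w)) has_derivative
    (\<lambda>d. Re d *\<^sub>R l + Im d *\<^sub>R (I * l))) (at z)"
proof -
  have D: "open D" "circular D"
    using assms(1) by (auto simp: slice_regular_on_def)
  have "of_real (Re z) + I * of_real (Im z) \<in> D"
    using circular_slice_pt_iff[OF D(2) assms(3)] assms(2) by (simp add: slice_pt_def)
  then obtain L where L: "((\<lambda>(u, v). h (of_real u + I * of_real v)) has_derivative L) (at (Re z, Im z))"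
    "(1/2) *\<^sub>R (L (1, 0) + I * L (0, 1)) = 0"
    using assms(1,3) unfolding slice_regular_on_def by blast
  have "L (1, 0) + I * L (0, 1) = 0"
    using L(2) by simp
  then have "I * L (1, 0) + I * (I * L (0, 1)) = 0"
    by (metis distrib_left mult_zero_right)
  then have L01: "L (0, 1) = I * L (1, 0)"
    using imag_units_sq_assoc[OF assms(3)] by simp
  have lin: "linear L"
    using L(1) has_derivative_linear by blast
  have "((\<lambda>w. (Re w, Im w)) has_derivative (\<lambda>w. (Re w, Im w))) (at z)"
    by (auto intro!: derivative_eq_intros)
  then have "((\<lambda>w. (\<lambda>(u, v). h (of_real u + I * of_real v)) (Re w, Im w)) has_derivative
      (\<lambda>d. L (Re d, Im d))) (at z)"
    by (rule has_derivative_compose) (use L(1) in simp)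
  moreover have "L (Re d, Im d) = Re d *\<^sub>R L (1, 0) + Im d *\<^sub>R (I * L (1, 0))" for d
  proof -
    have "(Re d, Im d) = Re d *\<^sub>R (1, 0) + Im d *\<^sub>R (0, 1)"
      by simp
    then show ?thesis
      using linear_add[OF lin] linear_scale[OF lin] L01 by metis
  qed
  ultimately show ?thesis
    using that[of "L (1, 0)"] by (simp add: slice_pt_def)
qed

text \<open>With differentials \<open>l\<close> and \<open>l'\<close> at the two conjugate points, the partial derivatives of the real
part of the stem are \<open>a\<close> and \<open>- c\<close>, those of the imaginary part are \<open>c\<close> and \<open>a\<close>, where
\<open>a = (l + l') / 2\<close> and \<open>c = - i (l - l') / 2\<close>. These are the Cauchy-Riemann equations in each
coordinate.\<close>

lemma holomorphic_stem_of:
  assumes "slice_regular_on D h"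
  shows "holomorphic_stem (stem_of h) (slice_dom D)"
proof -
  define R where "R w = (1/2) *\<^sub>R (h (slice_pt quat_i w) + h (slice_pt (- quat_i) w))" for w
  define T where "T w = (- 1/2) *\<^sub>R (quat_i * (h (slice_pt quat_i w) - h (slice_pt (- quat_i) w)))" for w
  have op: "open (slice_dom D)"
    using assms open_slice_dom by (auto simp: slice_regular_on_def)
  have "(\<lambda>w. Complex (s (R w)) (s (T w))) holomorphic_on slice_dom D"
    if s: "bounded_linear s" for s :: "quat \<Rightarrow> real"
    unfolding holomorphic_on_open[OF op]
  proof
    fix z assume z: "z \<in> slice_dom D"
    obtain l where l: "((\<lambda>w. h (slice_pt quat_i w)) has_derivative
        (\<lambda>d. Re d *\<^sub>R l + Im d *\<^sub>R (quat_i * l))) (at z)"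
      using slice_regular_on_imp_derivative[OF assms z quat_i_imag_unit] .
    obtain l' where l': "((\<lambda>w. h (slice_pt (- quat_i) w)) has_derivative
        (\<lambda>d. Re d *\<^sub>R l' + Im d *\<^sub>R (- quat_i * l'))) (at z)"
      using slice_regular_on_imp_derivative[OF assms z imag_units_uminus[OF quat_i_imag_unit]] .
    define a where "a = (1/2) *\<^sub>R (l + l')"
    define c where "c = (- 1/2) *\<^sub>R (quat_i * (l - l'))"
    have "(R has_derivative (\<lambda>d. (1/2) *\<^sub>R (Re d *\<^sub>R l + Im d *\<^sub>R (quat_i * l)
        + (Re d *\<^sub>R l' + Im d *\<^sub>R (- quat_i * l'))))) (at z)"
      unfolding R_def by (intro derivative_intros l l')
    moreover have "(1/2) *\<^sub>R (Re d *\<^sub>R l + Im d *\<^sub>R (quat_i * l)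
        + (Re d *\<^sub>R l' + Im d *\<^sub>R (- quat_i * l'))) = Re d *\<^sub>R a - Im d *\<^sub>R c" for d
      by (simp add: a_def c_def algebra_simps)
    ultimately have R: "(R has_derivative (\<lambda>d. Re d *\<^sub>R a - Im d *\<^sub>R c)) (at z)"
      by simp
    have "(T has_derivative (\<lambda>d. (- 1/2) *\<^sub>R (quat_i * ((Re d *\<^sub>R l + Im d *\<^sub>R (quat_i * l))
        - (Re d *\<^sub>R l' + Im d *\<^sub>R (- quat_i * l')))))) (at z)"
      unfolding T_def by (intro derivative_intros l l')
    moreover have "(- 1/2) *\<^sub>R (quat_i * ((Re d *\<^sub>R l + Im d *\<^sub>R (quat_i * l))
        - (Re d *\<^sub>R l' + Im d *\<^sub>R (- quat_i * l')))) = Re d *\<^sub>R c + Im d *\<^sub>R a" for d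
      by (simp add: a_def c_def algebra_simps imag_units_sq_assoc)
    ultimately have T: "(T has_derivative (\<lambda>d. Re d *\<^sub>R c + Im d *\<^sub>R a)) (at z)"
      by simp
    have "((\<lambda>w. Complex (s (R w)) (s (T w))) has_derivative
        (\<lambda>d. of_real (s (Re d *\<^sub>R a - Im d *\<^sub>R c)) + \<i> * of_real (s (Re d *\<^sub>R c + Im d *\<^sub>R a)))) (at z)"
      unfolding Complex_eq
      by (intro derivative_intros bounded_linear.has_derivative[OF s] R T)
    moreover have "of_real (s (Re d *\<^sub>R a - Im d *\<^sub>R c)) + \<i> * of_real (s (Re d *\<^sub>R c + Im d *\<^sub>R a))
        = Complex (s a) (s c) * d" for d
      by (simp add: complex_eq_iff linear_diff[OF bounded_linear.linear[OF s]]
          linear_add[OF bounded_linear.linear[OF s]] linear_scale[OF bounded_linear.linear[OF s]]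
          algebra_simps)
    ultimately show "\<exists>f'. DERIV (\<lambda>w. Complex (s (R w)) (s (T w))) z :> f'"
      unfolding has_field_derivative_def by auto
  qed
  moreover have "bounded_linear qRe" "bounded_linear qIm1" "bounded_linear qIm2" "bounded_linear qIm3"
    by (simp_all add: linear_conv_bounded_linear[symmetric] linear_iff)
  ultimately show ?thesis
    unfolding holomorphic_stem_def stem_of_def of_re_im_def biquat.sel R_def T_def by blast
qed

lemma slice_val_expand:
  "slice_val I a = Re (bq0 a) *\<^sub>R 1 + Im (bq0 a) *\<^sub>R I
     + (Re (bq1 a) *\<^sub>R quat_i + Im (bq1 a) *\<^sub>R (I * quat_i))
     + (Re (bq2 a) *\<^sub>R quat_j + Im (bq2 a) *\<^sub>R (I * quat_j))
     + (Re (bq3 a) *\<^sub>R quat_k + Im (bq3 a) *\<^sub>R (I * quat_k))"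
  by (simp add: slice_val_def quat_eq_iff quat_times_sel quat_i_def quat_j_def quat_k_def)

text \<open>The derivative of a holomorphic stem is multiplication by a complex scalar, and taking values in the
plane of \<open>I\<close> turns the scalar \<open>\<i>\<close> into left multiplication by \<open>I\<close>. Hence the derivative in the
direction \<open>y\<close> is \<open>I\<close> times the one in the direction \<open>x\<close>.\<close>

lemma slice_regular_onI:
  assumes D: "open D" "circular D" and S: "symmetric_stem S" "holomorphic_stem S (slice_dom D)"
    and h: "\<And>I z. I \<in> imag_units \<Longrightarrow> z \<in> slice_dom D \<Longrightarrow> h (slice_pt I z) = slice_val I (S z)"
  shows "slice_regular_on D h"
proof -
  have "slice_function_on D h"
    unfolding slice_function_on_def
  proof (intro exI conjI allI ballI impI)
    fix x y :: real
    have "S (Complex x (- y)) = bcnj (S (Complex x y))"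
      using S(1) by (metis complex_cnj symmetric_stem_def)
    then show "re_quat (S (Complex x (- y))) = re_quat (S (Complex x y))"
      "im_quat (S (Complex x (- y))) = - im_quat (S (Complex x y))"
      by (simp_all add: re_im_quat_simps)
    fix I assume I: "I \<in> imag_units" and "of_real x + I * of_real y \<in> D"
    then show "h (of_real x + I * of_real y) = re_quat (S (Complex x y)) + I * im_quat (S (Complex x y))"
      using h[OF I, of "Complex x y"] circular_slice_pt_iff[OF D(2) I, of "Complex x y"]
      by (simp add: slice_pt_def slice_val_def)
  qed
  moreover have "\<exists>L. ((\<lambda>(u, v). h (of_real u + I * of_real v)) has_derivative L) (at (x, y)) \<and>
      (1/2) *\<^sub>R (L (1, 0) + I * L (0, 1)) = 0"
    if I: "I \<in> imag_units" and xy: "of_real x + I * of_real y \<in> D" for I x y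
  proof -
    define z where "z = Complex x y"
    have op: "open (slice_dom D)"
      using D open_slice_dom by blast
    have z: "z \<in> slice_dom D"
      using xy circular_slice_pt_iff[OF D(2) I, of z] by (simp add: z_def slice_pt_def)
    obtain c0 c1 c2 c3 where c: "((\<lambda>z. bq0 (S z)) has_derivative (*) c0) (at z)"
      "((\<lambda>z. bq1 (S z)) has_derivative (*) c1) (at z)"
      "((\<lambda>z. bq2 (S z)) has_derivative (*) c2) (at z)"
      "((\<lambda>z. bq3 (S z)) has_derivative (*) c3) (at z)"
      using S(2) z unfolding holomorphic_stem_def holomorphic_on_open[OF op] has_field_derivative_def
      by blast
    define K where "K d = slice_val I (Biquat (c0 * d) (c1 * d) (c2 * d) (c3 * d))" for d
    have dK: "((\<lambda>w. slice_val I (S w)) has_derivative K) (at z)"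
      unfolding slice_val_expand K_def biquat.sel
      by (intro has_derivative_add has_derivative_scaleR_left c
          bounded_linear.has_derivative[OF bounded_linear_Re]
          bounded_linear.has_derivative[OF bounded_linear_Im])
    have lin: "bounded_linear (\<lambda>p. Complex (fst p) (snd p))"
      by (simp add: linear_conv_bounded_linear[symmetric] linear_iff complex_eq_iff)
    then have dC: "((\<lambda>p. Complex (fst p) (snd p)) has_derivative (\<lambda>p. Complex (fst p) (snd p))) (at (x, y))"
      by (rule bounded_linear_imp_has_derivative)
    have der: "((\<lambda>p. slice_val I (S (Complex (fst p) (snd p)))) has_derivative
        (\<lambda>p. K (Complex (fst p) (snd p)))) (at (x, y))"
      using has_derivative_compose[OF dC, of "\<lambda>w. slice_val I (S w)" K] dK by (simp add: z_def)
    define N where "N = (\<lambda>p. Complex (fst p) (snd p)) -` slice_dom D"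
    have "open N"
      unfolding N_def using op linear_continuous_on[OF lin] by (intro open_vimage)
    moreover have "(x, y) \<in> N"
      using z by (simp add: N_def z_def)
    moreover have "slice_val I (S (Complex (fst p) (snd p)))
        = (\<lambda>(u, v). h (of_real u + I * of_real v)) p" if "p \<in> N" for p
    proof -
      have "Complex (fst p) (snd p) \<in> slice_dom D"
        using that by (simp add: N_def)
      from h[OF I this] show ?thesis
        by (simp add: slice_pt_def case_prod_beta)
    qed
    ultimately have "((\<lambda>(u, v). h (of_real u + I * of_real v)) has_derivative
        (\<lambda>p. K (Complex (fst p) (snd p)))) (at (x, y))"
      using has_derivative_transform_within_open[OF der] by blast
    moreover have "K (Complex 1 0) + I * K (Complex 0 1) = 0"
    proof -
      have "K (Complex 0 1) = I * K (Complex 1 0)"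
        unfolding K_def slice_val_def distrib_left imag_units_sq_assoc[OF I]
        by (simp add: quat_eq_iff quat_times_sel)
      then show ?thesis
        by (simp add: imag_units_sq_assoc[OF I])
    qed
    ultimately show ?thesis
      by (intro exI[of _ "\<lambda>p. K (Complex (fst p) (snd p))"]) simp
  qed
  ultimately show ?thesis
    using D unfolding slice_regular_on_def by blast
qed


section \<open>Meromorphic functions that commute with complex conjugation\<close>

lemma eventually_at_cnj:
  assumes "eventually P (at (cnj z))"
  shows "eventually (\<lambda>w. P (cnj w)) (at z)"
proof -
  obtain d where d: "d > 0" "\<And>w. w \<noteq> cnj z \<Longrightarrow> dist w (cnj z) < d \<Longrightarrow> P w"
    using assms unfolding eventually_at by auto
  have "dist (cnj w) (cnj z) = dist w z" for w
    unfolding dist_norm by (metis complex_cnj_diff complex_mod_cnj)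
  then show ?thesis
    unfolding eventually_at using d by (metis complex_cnj_cancel_iff)
qed

lemma tendsto_at_cnj:
  assumes "\<And>w. f (cnj w) = cnj (f w)" "f \<midarrow>z\<rightarrow> c"
  shows "f \<midarrow>cnj z\<rightarrow> cnj c"
proof (rule tendstoI)
  fix e :: real assume "e > 0"
  then have "eventually (\<lambda>w. dist (f w) c < e) (at z)"
    using assms(2) by (rule tendstoD[rotated])
  then have "eventually (\<lambda>w. dist (f (cnj w)) c < e) (at (cnj z))"
    using eventually_at_cnj[of "\<lambda>w. dist (f w) c < e" "cnj z"] by simp
  moreover have "dist (f (cnj w)) c = dist (f w) (cnj c)" for w
    unfolding dist_norm assms(1) by (metis complex_cnj_cnj complex_cnj_diff complex_mod_cnj)
  ultimately show "eventually (\<lambda>w. dist (f w) (cnj c) < e) (at (cnj z))"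
    by simp
qed

lemma remove_sings_cnj:
  assumes "\<And>w. f (cnj w) = cnj (f w)"
  shows "remove_sings f (cnj z) = cnj (remove_sings f z)"
proof (cases "\<exists>c. f \<midarrow>z\<rightarrow> c")
  case True
  then obtain c where "f \<midarrow>z\<rightarrow> c"
    by blast
  then show ?thesis
    using tendsto_at_cnj[of f, OF assms] remove_sings_eqI by metis
next
  case False
  then have "\<not> (\<exists>c. f \<midarrow>cnj z\<rightarrow> c)"
    using tendsto_at_cnj[where f = f and z = "cnj z", OF assms] by auto
  then show ?thesis
    using False by (simp add: remove_sings_def)
qed

text \<open>The limit is asserted for all large exponents, since the four coordinates of a stem will have to
share one exponent.\<close>

lemma meromorphic_pole_order_bound:
  assumes "f meromorphic_on {z}"
  obtains N where "\<And>n. n \<ge> N \<Longrightarrow> \<exists>c. (\<lambda>w. (w - z) ^ n * f w) \<midarrow>z\<rightarrow> c"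
proof -
  have iso: "isolated_singularity_at f z" and ne: "not_essential f z"
    using assms by (auto simp: meromorphic_at_iff)
  show ?thesis
  proof (cases "is_pole f z")
    case False
    then obtain c where c: "f \<midarrow>z\<rightarrow> c"
      using ne by (auto simp: not_essential_def)
    have "(\<lambda>w. (w - z) ^ n * f w) \<midarrow>z\<rightarrow> (z - z) ^ n * c" for n
      by (intro tendsto_intros c)
    then show ?thesis
      using that by blast
  next
    case True
    obtain r where r: "r > 0" "f holomorphic_on ball z r - {z}"
      using iso by (auto simp: isolated_singularity_at_def intro: analytic_imp_holomorphic)
    define k where "k = nat (- zorder f z)"
    define g where "g = zor_poly f z"
    obtain s where s: "s > 0" "g holomorphic_on cball z s"
      "\<And>w. w \<in> cball z s - {z} \<Longrightarrow> f w = g w / (w - z) ^ k"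
      using zorder_exist_pole[OF r(2) _ _ True] r(1) unfolding g_def k_def by auto
    have "g \<midarrow>z\<rightarrow> g z"
    proof -
      have "g holomorphic_on ball z s"
        using s(2) by (rule holomorphic_on_subset) auto
      then have "isCont g z"
        using s(1) by (meson centre_in_ball continuous_on_interior holomorphic_on_imp_continuous_on
            interior_open open_ball continuous_on_eq_continuous_at)
      then show ?thesis
        by (simp add: isCont_def)
    qed
    have ev: "eventually (\<lambda>w. w \<in> cball z s - {z}) (at z)"
      using eventually_at_in_open[of "ball z s" z] s(1) by (auto elim: eventually_mono)
    have "(\<lambda>w. (w - z) ^ n * f w) \<midarrow>z\<rightarrow> (z - z) ^ (n - k) * g z" if "n \<ge> k" for n
    proof (rule Lim_transform_eventually)
      show "(\<lambda>w. (w - z) ^ (n - k) * g w) \<midarrow>z\<rightarrow> (z - z) ^ (n - k) * g z"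
        by (intro tendsto_intros \<open>g \<midarrow>z\<rightarrow> g z\<close>)
      show "eventually (\<lambda>w. (w - z) ^ (n - k) * g w = (w - z) ^ n * f w) (at z)"
        using ev
      proof eventually_elim
        case (elim w)
        have "(w - z) ^ n = (w - z) ^ (n - k) * (w - z) ^ k"
          using that by (metis le_add_diff_inverse2 power_add)
        then show ?case
          using elim s(3)[OF elim] by simp
      qed
    qed
    then show ?thesis
      using that by blast
  qed
qed

text \<open>The polynomial \<open>z\<^sup>2 - 2 Re p z + \<bar>p\<bar>\<^sup>2\<close> in factored form, that is, the stem of \<open>sphere_poly\<close>; see
\<open>sphere_poly_slice_pt\<close>.\<close>

definition sphere_factor :: "complex \<Rightarrow> complex \<Rightarrow> complex" where
  "sphere_factor p z = (z - p) * (z - cnj p)"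

lemma sphere_factor_cnj: "sphere_factor p (cnj z) = cnj (sphere_factor p z)"
  by (simp add: sphere_factor_def mult.commute)

lemma sphere_factor_cnj': "sphere_factor (cnj p) z = sphere_factor p z"
  by (simp add: sphere_factor_def mult.commute)

lemma sphere_factor_eq_0_iff: "sphere_factor p z = 0 \<longleftrightarrow> z = p \<or> z = cnj p"
  by (auto simp: sphere_factor_def)

lemma sphere_factor_power_removes_pole:
  assumes "f meromorphic_on {p}"
  obtains N where "\<And>n. n \<ge> N \<Longrightarrow> remove_sings (\<lambda>w. sphere_factor p w ^ n * f w) analytic_on {p}"
proof -
  obtain N where N: "\<And>n. n \<ge> N \<Longrightarrow> \<exists>c. (\<lambda>w. (w - p) ^ n * f w) \<midarrow>p\<rightarrow> c"
    using meromorphic_pole_order_bound[OF assms] by blast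
  have "remove_sings (\<lambda>w. sphere_factor p w ^ n * f w) analytic_on {p}" if n: "n \<ge> N" for n
  proof -
    obtain c where c: "(\<lambda>w. (w - p) ^ n * f w) \<midarrow>p\<rightarrow> c"
      using N n by blast
    have "(\<lambda>w. sphere_factor p w ^ n * f w) meromorphic_on {p}"
      unfolding sphere_factor_def by (intro meromorphic_intros assms)
    moreover have "(\<lambda>w. (w - cnj p) ^ n * ((w - p) ^ n * f w)) \<midarrow>p\<rightarrow> (p - cnj p) ^ n * c"
      by (intro tendsto_intros c)
    then have "(\<lambda>w. sphere_factor p w ^ n * f w) \<midarrow>p\<rightarrow> (p - cnj p) ^ n * c"
      by (simp add: sphere_factor_def power_mult_distrib mult_ac)
    ultimately show ?thesis
      by (intro remove_sings_analytic_at) (auto simp: meromorphic_at_iff)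
  qed
  then show ?thesis
    using that by blast
qed

lemma quat_numeral_sel [simp]:
  "qRe (numeral n) = numeral n" "qIm1 (numeral n) = 0" "qIm2 (numeral n) = 0" "qIm3 (numeral n) = 0"
  using quat_of_real_sel[of "numeral n"] by (simp_all only: of_real_numeral)

lemma sphere_poly_slice_pt:
  assumes "I \<in> imag_units" "J \<in> imag_units"
  shows "sphere_poly (slice_pt J p) (slice_pt I z) = slice_val I (bscal (sphere_factor p z))"
proof -
  have J: "qRe (slice_pt J p) = Re p" "(norm (slice_pt J p))\<^sup>2 = (Re p)\<^sup>2 + (Im p)\<^sup>2"
  proof -
    have "(norm (slice_pt J p))\<^sup>2 = (Re p)\<^sup>2 + ((qIm1 J)\<^sup>2 + (qIm2 J)\<^sup>2 + (qIm3 J)\<^sup>2) * (Im p)\<^sup>2"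
      using assms(2)[unfolded imag_units_iff, THEN conjunct1]
      by (simp add: norm_quat_eq slice_pt_def quat_times_sel power_mult_distrib algebra_simps)
    then show "(norm (slice_pt J p))\<^sup>2 = (Re p)\<^sup>2 + (Im p)\<^sup>2"
      using assms(2) by (simp add: imag_units_iff)
    show "qRe (slice_pt J p) = Re p"
      using assms(2) by (simp add: slice_pt_def quat_times_sel imag_units_iff)
  qed
  have "(slice_pt I z)\<^sup>2 = slice_pt I z * slice_pt I z"
    by (simp add: power2_eq_square)
  also have "\<dots> = of_real ((Re z)\<^sup>2) + I * of_real (2 * Re z * Im z) + I * I * of_real ((Im z)\<^sup>2)"
    unfolding slice_pt_def
    by (simp add: quat_eq_iff quat_times_sel power2_eq_square algebra_simps)
  also have "\<dots> = of_real ((Re z)\<^sup>2 - (Im z)\<^sup>2) + I * of_real (2 * Re z * Im z)"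
    by (simp add: imag_units_sq[OF assms(1)])
  finally have sq: "(slice_pt I z)\<^sup>2 = \<dots>" .
  have "sphere_factor p z = Complex ((Re z)\<^sup>2 - (Im z)\<^sup>2 - 2 * Re p * Re z + ((Re p)\<^sup>2 + (Im p)\<^sup>2))
      (2 * Re z * Im z - 2 * Re p * Im z)"
    by (simp add: sphere_factor_def complex_eq_iff power2_eq_square algebra_simps)
  then show ?thesis
    unfolding sphere_poly_def sq J slice_val_bscal
    by (simp add: slice_pt_def quat_eq_iff quat_times_sel algebra_simps)
qed

lemma slice_val_bscal_mult:
  assumes "I \<in> imag_units"
  shows "slice_val I (bscal c * a) = slice_val I (bscal c) * slice_val I a"
proof -
  have "slice_val I (bscal c) * I = I * slice_val I (bscal c)"
    by (simp add: slice_val_bscal slice_pt_def distrib_left distrib_right of_real_quat_central mult.assoc)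
  then show ?thesis
    by (simp add: slice_val_mult[OF assms] slice_val_def[of I a] distrib_left flip: mult.assoc)
qed

lemma slice_val_bscal_power_mult:
  assumes "I \<in> imag_units"
  shows "slice_val I (bscal (c ^ n) * a) = slice_val I (bscal c) ^ n * slice_val I a"
proof (induction n)
  case 0
  have "bscal 1 = 1"
    by (simp add: biquat_eq_iff)
  then show ?case
    by simp
next
  case (Suc n)
  have "bscal (c ^ Suc n) * a = bscal c * (bscal (c ^ n) * a)"
    by (simp add: bscal_mult flip: mult.assoc)
  then show ?case
    using Suc by (simp add: slice_val_bscal_mult[OF assms] mult.assoc)
qed


section \<open>Semi-regular functions and their stems\<close>

definition meromorphic_stem :: "(complex \<Rightarrow> biquat) \<Rightarrow> complex set \<Rightarrow> bool" where
  "meromorphic_stem S A \<longleftrightarrow> (\<lambda>z. bq0 (S z)) meromorphic_on A \<and> (\<lambda>z. bq1 (S z)) meromorphic_on A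
     \<and> (\<lambda>z. bq2 (S z)) meromorphic_on A \<and> (\<lambda>z. bq3 (S z)) meromorphic_on A"

abbreviation stem :: "pfun \<Rightarrow> complex \<Rightarrow> biquat" where
  "stem f \<equiv> stem_of (\<lambda>q. the (f q))"

lemma SEM_D:
  assumes "f \<in> SEM \<Omega>"
  shows "dom f \<subseteq> \<Omega>" "open (dom f)" "circular (dom f)"
    "slice_regular_on (dom f) (\<lambda>q. the (f q))" "slice_function_on (dom f) (\<lambda>q. the (f q))"
  using assms by (auto simp: SEM_def slice_regular_on_def)

text \<open>The condition on poles in terms of stems: after multiplication by a power of the spherical polynomial
the stem extends holomorphically over the two parameters \<open>z\<close> and \<open>cnj z\<close> of the singular sphere.\<close>

lemma SEM_pole:
  assumes f: "f \<in> SEM \<Omega>" and z: "z \<in> slice_dom \<Omega>" "z \<notin> slice_dom (dom f)"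
  obtains U T m where "open U" "circular U" "z \<in> slice_dom U" "holomorphic_stem T (slice_dom U)"
    "\<And>w. w \<in> slice_dom U \<Longrightarrow> w \<noteq> z \<Longrightarrow> w \<noteq> cnj z \<Longrightarrow>
       w \<in> slice_dom (dom f) \<and> T w = bscal (sphere_factor z w ^ m) * stem f w"
proof -
  define p where "p = slice_pt quat_i z"
  have "p \<in> \<Omega> - dom f"
    using z by (simp add: p_def slice_dom_def)
  then obtain U m h where U: "open U" "circular U" "U - dom f = quat_sphere p" "slice_regular_on U h"
    and h: "\<forall>q\<in>U - quat_sphere p. h q = sphere_poly p q ^ m * the (f q)"
    using f unfolding SEM_def by blast
  have hpp: "half_plane_pt p = Complex (Re z) \<bar>Im z\<bar>"
    unfolding p_def by (simp add: half_plane_pt_slice_pt)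
  have "p \<in> U"
    using U(3) by (auto simp: quat_sphere_eq_vimage)
  then have "z \<in> slice_dom U"
    by (simp add: p_def slice_dom_def)
  moreover have "holomorphic_stem (stem_of h) (slice_dom U)"
    using U(4) holomorphic_stem_of by blast
  moreover have "w \<in> slice_dom (dom f) \<and> stem_of h w = bscal (sphere_factor z w ^ m) * stem f w"
    if w: "w \<in> slice_dom U" "w \<noteq> z" "w \<noteq> cnj z" for w
  proof -
    have wI: "slice_pt I w \<in> U - quat_sphere p" if "I \<in> imag_units" for I
    proof -
      have "Complex (Re w) \<bar>Im w\<bar> \<noteq> Complex (Re z) \<bar>Im z\<bar>"
        using w(2,3) by (auto simp: complex_eq_iff abs_eq_iff)
      then have "half_plane_pt (slice_pt I w) \<noteq> half_plane_pt p"
        using hpp half_plane_pt_slice_pt[OF that] by simp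
      then show ?thesis
        using circular_slice_pt_iff[OF U(2) that] w(1) by (simp add: quat_sphere_eq_vimage)
    qed
    then have "slice_pt quat_i w \<in> dom f"
      using U(3) quat_i_imag_unit by blast
    then have wf: "w \<in> slice_dom (dom f)"
      by (simp add: slice_dom_def)
    have "slice_val I (stem_of h w) = slice_val I (bscal (sphere_factor z w ^ m) * stem f w)"
      if I: "I \<in> imag_units" for I
    proof -
      have "slice_val I (stem_of h w) = h (slice_pt I w)"
        using slice_function_on_stem_of[OF _ U(2) w(1) I] U(4) by (simp add: slice_regular_on_def)
      also have "\<dots> = sphere_poly p (slice_pt I w) ^ m * the (f (slice_pt I w))"
        using h wI[OF I] by blast
      also have "the (f (slice_pt I w)) = slice_val I (stem f w)"
        using slice_function_on_stem_of[OF SEM_D(5)[OF f] SEM_D(3)[OF f] wf I] .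
      finally show ?thesis
        by (simp add: p_def sphere_poly_slice_pt[OF I] slice_val_bscal_power_mult[OF I])
    qed
    then show ?thesis
      using wf slice_val_inj[OF quat_i_imag_unit] imag_units_uminus quat_i_imag_unit by blast
  qed
  ultimately show ?thesis
    using that U(1,2) by blast
qed

lemma eventually_at_ne_ne: "eventually (\<lambda>w. w \<noteq> a \<and> w \<noteq> b) (at (z::complex))"
  by (intro eventually_conj eventually_neq_at_within)

lemma SEM_cosparse:
  assumes f: "f \<in> SEM \<Omega>" and "open \<Omega>"
  shows "eventually (\<lambda>z. z \<in> slice_dom (dom f)) (cosparse (slice_dom \<Omega>))"
  unfolding eventually_cosparse_open_eq[OF open_slice_dom[OF assms(2)]]
proof
  fix z assume z: "z \<in> slice_dom \<Omega>"
  show "eventually (\<lambda>z. z \<in> slice_dom (dom f)) (at z)"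
  proof (cases "z \<in> slice_dom (dom f)")
    case True
    then show ?thesis
      using open_slice_dom[OF SEM_D(2)[OF f]] by (intro eventually_at_in_open')
  next
    case False
    obtain U T m where U: "open U" "z \<in> slice_dom U"
      "\<And>w. w \<in> slice_dom U \<Longrightarrow> w \<noteq> z \<Longrightarrow> w \<noteq> cnj z \<Longrightarrow> w \<in> slice_dom (dom f)"
      using SEM_pole[OF f z False] by metis
    have "eventually (\<lambda>w. w \<in> slice_dom U) (at z)"
      using U(2) open_slice_dom[OF U(1)] by (intro eventually_at_in_open')
    then show ?thesis
      using eventually_at_ne_ne[of z "cnj z" z] by eventually_elim (use U(3) in blast)
  qed
qed

lemma SEM_meromorphic_stem:
  assumes f: "f \<in> SEM \<Omega>"
  shows "meromorphic_stem (stem f) (slice_dom \<Omega>)"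
proof -
  have hol: "holomorphic_stem (stem f) (slice_dom (dom f))"
    using SEM_D(4)[OF f] holomorphic_stem_of by blast
  have "meromorphic_stem (stem f) {z}" if z: "z \<in> slice_dom \<Omega>" for z
  proof (cases "z \<in> slice_dom (dom f)")
    case True
    have "g meromorphic_on {z}" if "g holomorphic_on slice_dom (dom f)" for g
      using that True open_slice_dom[OF SEM_D(2)[OF f]]
      by (meson analytic_on_imp_meromorphic_on holomorphic_on_imp_analytic_at)
    then show ?thesis
      using hol unfolding holomorphic_stem_def meromorphic_stem_def by blast
  next
    case False
    obtain U T m where U: "open U" "z \<in> slice_dom U" "holomorphic_stem T (slice_dom U)"
      and T: "\<And>w. w \<in> slice_dom U \<Longrightarrow> w \<noteq> z \<Longrightarrow> w \<noteq> cnj z \<Longrightarrow>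
        T w = bscal (sphere_factor z w ^ m) * stem f w"
      using SEM_pole[OF f z False] by metis
    have *: "(\<lambda>w. s (stem f w)) meromorphic_on {z}"
      if s: "(\<lambda>w. s (T w)) holomorphic_on slice_dom U" "\<And>c a. s (bscal c * a) = c * s a"
      for s :: "biquat \<Rightarrow> complex"
    proof -
      have "(\<lambda>w. s (T w)) meromorphic_on {z}"
        using s(1) U(2) open_slice_dom[OF U(1)]
        by (meson analytic_on_imp_meromorphic_on holomorphic_on_imp_analytic_at)
      then have "(\<lambda>w. s (T w) / sphere_factor z w ^ m) meromorphic_on {z}"
        unfolding sphere_factor_def by (intro meromorphic_intros)
      moreover have "eventually (\<lambda>w. s (T w) / sphere_factor z w ^ m = s (stem f w)) (at z)"
      proof -
        have "eventually (\<lambda>w. w \<in> slice_dom U) (at z)"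
          using U(2) open_slice_dom[OF U(1)] by (intro eventually_at_in_open')
        then show ?thesis
          using eventually_at_ne_ne[of z "cnj z" z]
        proof eventually_elim
          case (elim w)
          then have "sphere_factor z w \<noteq> 0"
            by (simp add: sphere_factor_eq_0_iff)
          then show ?case
            using elim T s(2) by simp
        qed
      qed
      ultimately show ?thesis
        by (subst meromorphic_on_cong[where g = "\<lambda>w. s (T w) / sphere_factor z w ^ m"])
           (auto elim: eventually_mono)
    qed
    show ?thesis
      using U(3) unfolding holomorphic_stem_def meromorphic_stem_def
      by (intro conjI *) (auto simp: biquat_times_sel)
  qed
  then show ?thesis
    unfolding meromorphic_stem_def by (meson meromorphic_on_meromorphic_at)
qed

text \<open>The unit \<open>I\<close> is unique unless \<open>q\<close> is real; at a real point any unit gives the same value when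
the stem is symmetric, because then the imaginary part of the stem vanishes there.\<close>

definition induced_pfun :: "quat set \<Rightarrow> (complex \<Rightarrow> biquat) \<Rightarrow> pfun" where
  "induced_pfun W S = (\<lambda>q. if q \<in> W
     then Some (slice_val (SOME I. I \<in> imag_units \<and> slice_pt I (half_plane_pt q) = q) (S (half_plane_pt q)))
     else None)"

lemma dom_induced_pfun [simp]: "dom (induced_pfun W S) = W"
  by (auto simp: induced_pfun_def dom_def)

lemma induced_pfun_value:
  assumes W: "circular W" and S: "symmetric_stem S" and I: "I \<in> imag_units" and z: "z \<in> slice_dom W"
  shows "the (induced_pfun W S (slice_pt I z)) = slice_val I (S z)"
proof -
  define q where "q = slice_pt I z"
  define J where "J = (SOME I. I \<in> imag_units \<and> slice_pt I (half_plane_pt q) = q)"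
  have "\<exists>I. I \<in> imag_units \<and> slice_pt I (half_plane_pt q) = q"
    using slice_pt_half_plane_pt[of q] by metis
  then have J: "J \<in> imag_units \<and> slice_pt J (half_plane_pt q) = q"
    unfolding J_def by (rule someI_ex)
  have "q \<in> W"
    using z circular_slice_pt_iff[OF W I] by (simp add: q_def)
  then have v: "the (induced_pfun W S q) = slice_val J (S (half_plane_pt q))"
    by (simp add: induced_pfun_def J_def)
  (* off the real axis the point determines the unit; on it the stem has no imaginary part *)
  have cong: "slice_val K (S z) = slice_val I (S z)" if "slice_pt K z = slice_pt I z" for K
  proof (cases "Im z = 0")
    case True
    then have "S z = bcnj (S z)"
      using S unfolding symmetric_stem_def by (metis complex_cnj complex_surj minus_zero)
    then have "im_quat (S z) = - im_quat (S z)"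
      by (metis re_im_quat_simps(12))
    then have "im_quat (S z) = 0"
      by (simp add: quat_eq_iff)
    then show ?thesis
      by (simp add: slice_val_def)
  next
    case False
    then have "K = I"
      using that by (simp add: slice_pt_def)
    then show ?thesis
      by simp
  qed
  have "half_plane_pt q = z \<or> half_plane_pt q = cnj z"
    using half_plane_pt_slice_pt[OF I] half_plane_pt_cases q_def by simp
  then have "slice_val J (S (half_plane_pt q)) = slice_val I (S z)"
  proof
    assume h: "half_plane_pt q = z"
    then have "slice_pt J z = slice_pt I z"
      using J q_def by metis
    from cong[OF this] show ?thesis
      by (simp only: h)
  next
    assume h: "half_plane_pt q = cnj z"
    then have "slice_pt (- J) z = slice_pt I z"
      using J slice_pt_cnj q_def by metis
    moreover have "slice_val J (S (cnj z)) = slice_val (- J) (S z)"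
      using S slice_val_simps(5)[of "- J" "S z"] by (simp add: symmetric_stem_def)
    ultimately show ?thesis
      using cong h by metis
  qed
  then show ?thesis
    using v by (simp only: q_def)
qed

lemma sel_bscal_mult: "bq0 (bscal c * a) = c * bq0 a" "bq1 (bscal c * a) = c * bq1 a"
  "bq2 (bscal c * a) = c * bq2 a" "bq3 (bscal c * a) = c * bq3 a"
  by (simp_all add: biquat_times_sel)

text \<open>At a singular sphere with parameter \<open>z\<^sub>0\<close>, take for \<open>U\<close> the preimage of a small neighbourhood of
\<open>z\<^sub>0\<close>. The extension required by the definition of a pole is induced by the stem \<open>H\<close> that arises
from the given one by multiplication with a power of the spherical polynomial and removal of
the singularities. The power must suffice for all four coordinates, both at \<open>z\<^sub>0\<close> and
at \<open>cnj z\<^sub>0\<close>. Removal of singularities commutes with conjugation, so \<open>H\<close> is again symmetric.\<close>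

lemma induced_pfun_SEM:
  assumes \<Omega>: "open \<Omega>" "circular \<Omega>" and W: "open W" "circular W" "W \<subseteq> \<Omega>"
    and S: "symmetric_stem S" "holomorphic_stem S (slice_dom W)" "meromorphic_stem S (slice_dom \<Omega>)"
    and cosparse: "eventually (\<lambda>z. z \<in> slice_dom W) (cosparse (slice_dom \<Omega>))"
  shows "induced_pfun W S \<in> SEM \<Omega>"
proof -
  let ?f = "induced_pfun W S"
  have "slice_regular_on W (\<lambda>q. the (?f q))"
    by (rule slice_regular_onI[OF W(1,2) S(1,2)]) (rule induced_pfun_value[OF W(2) S(1)])
  moreover have "\<exists>U. open U \<and> circular U \<and> U \<subseteq> \<Omega> \<and> U - W = quat_sphere p \<and>
        (\<exists>(m::nat) h. slice_regular_on U h \<and>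
           (\<forall>q \<in> U - quat_sphere p. h q = sphere_poly p q ^ m * the (?f q)))"
    if p: "p \<in> \<Omega> - W" for p
  proof -
    define z0 where "z0 = half_plane_pt p"
    have z0: "z0 \<in> slice_dom \<Omega>" "z0 \<notin> slice_dom W"
      using p circular_mem_iff \<Omega>(2) W(2) by (auto simp: z0_def)
    have z0c: "cnj z0 \<in> slice_dom \<Omega>"
      using z0 slice_dom_cnj[OF \<Omega>(2)] by simp
    have "eventually (\<lambda>z. z \<in> slice_dom W) (at z0)"
      using cosparse z0(1) by (rule eventually_cosparse_imp_eventually_at)
    moreover have "eventually (\<lambda>z. z \<in> slice_dom \<Omega>) (nhds z0)"
      using open_slice_dom[OF \<Omega>(1)] z0(1) by (intro eventually_nhds_in_open)
    ultimately obtain B where B: "open B" "z0 \<in> B" "B \<subseteq> slice_dom \<Omega>" "B - {z0} \<subseteq> slice_dom W"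
    proof -
      assume that: "\<And>B. open B \<Longrightarrow> z0 \<in> B \<Longrightarrow> B \<subseteq> slice_dom \<Omega> \<Longrightarrow> B - {z0} \<subseteq> slice_dom W \<Longrightarrow> thesis"
      assume "eventually (\<lambda>z. z \<in> slice_dom W) (at z0)"
      then obtain B where "open B" "z0 \<in> B" "\<forall>z\<in>B. z \<noteq> z0 \<longrightarrow> z \<in> slice_dom W"
        unfolding eventually_at_topological by auto
      then show thesis
        using that[of "B \<inter> slice_dom \<Omega>"] open_slice_dom[OF \<Omega>(1)] z0(1) by blast
    qed
    define U where "U = half_plane_pt -` B"
    have U: "open U" "circular U"
      using B(1) open_vimage_half_plane_pt circular_vimage_half_plane_pt by (auto simp: U_def)
    have U\<Omega>: "U \<subseteq> \<Omega>"
      using B(3) circular_mem_iff[OF \<Omega>(2)] by (auto simp: U_def)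
    have UW: "U - W = quat_sphere p"
      using B z0 circular_mem_iff[OF W(2)] by (auto simp: U_def quat_sphere_eq_vimage z0_def[symmetric])
    have slice_U: "z \<in> slice_dom W" if "z \<in> slice_dom U" "z \<noteq> z0" "z \<noteq> cnj z0" for z
    proof -
      have "Complex (Re z) \<bar>Im z\<bar> \<in> B"
        using that(1) half_plane_pt_slice_pt[OF quat_i_imag_unit] by (simp add: slice_dom_def U_def)
      moreover have "Complex (Re z) \<bar>Im z\<bar> \<noteq> z0"
        using half_plane_pt_cases[of z] that by auto
      ultimately show ?thesis
        using B(4) slice_dom_half_plane_iff[OF W(2)] by blast
    qed
    have ex: "\<exists>N. \<forall>n\<ge>N. remove_sings (\<lambda>w. sphere_factor z0 w ^ n * g w) analytic_on {z0}
        \<and> remove_sings (\<lambda>w. sphere_factor z0 w ^ n * g w) analytic_on {cnj z0}"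
      if "g meromorphic_on slice_dom \<Omega>" for g
    proof -
      have "g meromorphic_on {z0}" "g meromorphic_on {cnj z0}"
        using that z0(1) z0c by (auto intro: meromorphic_on_subset)
      then obtain N N' where
        "\<And>n. n \<ge> N \<Longrightarrow> remove_sings (\<lambda>w. sphere_factor z0 w ^ n * g w) analytic_on {z0}"
        "\<And>n. n \<ge> N' \<Longrightarrow> remove_sings (\<lambda>w. sphere_factor z0 w ^ n * g w) analytic_on {cnj z0}"
        using sphere_factor_power_removes_pole[of g z0] sphere_factor_power_removes_pole[of g "cnj z0"]
        unfolding sphere_factor_cnj' by metis
      then show ?thesis
        by (intro exI[of _ "max N N'"]) auto
    qed
    obtain N0 where N0: "\<forall>n\<ge>N0. remove_sings (\<lambda>w. sphere_factor z0 w ^ n * bq0 (S w)) analytic_on {z0}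
        \<and> remove_sings (\<lambda>w. sphere_factor z0 w ^ n * bq0 (S w)) analytic_on {cnj z0}"
      using ex S(3) unfolding meromorphic_stem_def by blast
    obtain N1 where N1: "\<forall>n\<ge>N1. remove_sings (\<lambda>w. sphere_factor z0 w ^ n * bq1 (S w)) analytic_on {z0}
        \<and> remove_sings (\<lambda>w. sphere_factor z0 w ^ n * bq1 (S w)) analytic_on {cnj z0}"
      using ex S(3) unfolding meromorphic_stem_def by blast
    obtain N2 where N2: "\<forall>n\<ge>N2. remove_sings (\<lambda>w. sphere_factor z0 w ^ n * bq2 (S w)) analytic_on {z0}
        \<and> remove_sings (\<lambda>w. sphere_factor z0 w ^ n * bq2 (S w)) analytic_on {cnj z0}"
      using ex S(3) unfolding meromorphic_stem_def by blast
    obtain N3 where N3: "\<forall>n\<ge>N3. remove_sings (\<lambda>w. sphere_factor z0 w ^ n * bq3 (S w)) analytic_on {z0}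
        \<and> remove_sings (\<lambda>w. sphere_factor z0 w ^ n * bq3 (S w)) analytic_on {cnj z0}"
      using ex S(3) unfolding meromorphic_stem_def by blast
    (* one exponent that serves all four coordinates *)
    define m where "m = max (max N0 N1) (max N2 N3)"
    define H where "H z = Biquat (remove_sings (\<lambda>w. sphere_factor z0 w ^ m * bq0 (S w)) z)
        (remove_sings (\<lambda>w. sphere_factor z0 w ^ m * bq1 (S w)) z)
        (remove_sings (\<lambda>w. sphere_factor z0 w ^ m * bq2 (S w)) z)
        (remove_sings (\<lambda>w. sphere_factor z0 w ^ m * bq3 (S w)) z)" for z
    have H_sym: "symmetric_stem H"
      using S(1) unfolding symmetric_stem_def biquat_eq_iff H_def
      by (simp add: remove_sings_cnj sphere_factor_cnj)
    have ana: "(\<lambda>w. sphere_factor z0 w ^ m * s (S w)) analytic_on {z}"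
      if "z \<in> slice_dom W" "(\<lambda>w. s (S w)) holomorphic_on slice_dom W" for z and s :: "biquat \<Rightarrow> complex"
    proof -
      have "(\<lambda>w. sphere_factor z0 w ^ m * s (S w)) holomorphic_on slice_dom W"
        unfolding sphere_factor_def by (intro holomorphic_intros that)
      then show ?thesis
        using that(1) open_slice_dom[OF W(1)] holomorphic_on_imp_analytic_at by blast
    qed
    have H_hol: "holomorphic_stem H (slice_dom U)"
    proof -
      have "remove_sings (\<lambda>w. sphere_factor z0 w ^ m * s (S w)) holomorphic_on slice_dom U"
        if "(\<lambda>w. s (S w)) holomorphic_on slice_dom W"
          "remove_sings (\<lambda>w. sphere_factor z0 w ^ m * s (S w)) analytic_on {z0}
           \<and> remove_sings (\<lambda>w. sphere_factor z0 w ^ m * s (S w)) analytic_on {cnj z0}"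
        for s :: "biquat \<Rightarrow> complex"
      proof -
        have "remove_sings (\<lambda>w. sphere_factor z0 w ^ m * s (S w)) analytic_on {z}"
          if z: "z \<in> slice_dom U" for z
          using that slice_U ana remove_sings_analytic_on \<open>_ analytic_on {z0} \<and> _\<close> \<open>_ holomorphic_on slice_dom W\<close>
          by (cases "z = z0 \<or> z = cnj z0") auto
        then show ?thesis
          by (meson analytic_imp_holomorphic analytic_on_analytic_at)
      qed
      moreover have "m \<ge> N0" "m \<ge> N1" "m \<ge> N2" "m \<ge> N3"
        by (auto simp: m_def)
      ultimately show ?thesis
        using S(2) N0 N1 N2 N3 unfolding holomorphic_stem_def H_def biquat.sel by blast
    qed
    have hv: "the (induced_pfun U H (slice_pt I z)) = slice_val I (H z)"
      if "I \<in> imag_units" "z \<in> slice_dom U" for I z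
      using induced_pfun_value[OF U(2) H_sym that] .
    have "slice_regular_on U (\<lambda>q. the (induced_pfun U H q))"
      by (rule slice_regular_onI[OF U H_sym H_hol]) (rule hv)
    moreover have "the (induced_pfun U H q) = sphere_poly p q ^ m * the (?f q)"
      if q: "q \<in> U - quat_sphere p" for q
    proof -
      obtain I where I: "I \<in> imag_units" "slice_pt I (half_plane_pt q) = q"
        using slice_pt_half_plane_pt .
      obtain J where J: "J \<in> imag_units" "slice_pt J (half_plane_pt p) = p"
        using slice_pt_half_plane_pt .
      define z where "z = half_plane_pt q"
      have qz: "q = slice_pt I z" and pz: "p = slice_pt J z0"
        using I J by (simp_all add: z_def z0_def)
      have zU: "z \<in> slice_dom U" and zW: "z \<in> slice_dom W"
        using q UW circular_mem_iff[OF U(2)] circular_mem_iff[OF W(2)] by (auto simp: z_def)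
      have "H z = bscal (sphere_factor z0 z ^ m) * S z"
        using S(2) ana[OF zW] unfolding holomorphic_stem_def H_def biquat_eq_iff sel_bscal_mult
        by simp
      then show ?thesis
        using hv[OF I(1) zU] induced_pfun_value[OF W(2) S(1) I(1) zW]
        by (simp add: qz pz sphere_poly_slice_pt[OF I(1) J(1)] slice_val_bscal_power_mult[OF I(1)])
    qed
    ultimately show ?thesis
      using U U\<Omega> UW by blast
  qed
  ultimately show ?thesis
    using W(3) unfolding SEM_def by auto
qed


section \<open>Partial functions with a holomorphic stem\<close>

text \<open>The property that all expressions formed from semi-regular functions by the operations on partial
functions share: it is stable under these operations by mere intersection of domains, and it suffices
for the identity principle below.\<close>

definition stem_fun :: "quat set \<Rightarrow> pfun \<Rightarrow> (complex \<Rightarrow> biquat) \<Rightarrow> bool" where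
  "stem_fun \<Omega> A S \<longleftrightarrow> open (dom A) \<and> circular (dom A) \<and>
     eventually (\<lambda>z. z \<in> slice_dom (dom A)) (cosparse (slice_dom \<Omega>)) \<and>
     dom A \<subseteq> \<Omega> \<and> holomorphic_stem S (slice_dom (dom A)) \<and>
     (\<forall>I\<in>imag_units. \<forall>z\<in>slice_dom (dom A). the (A (slice_pt I z)) = slice_val I (S z))"

lemma stem_fun_SEM:
  assumes "open \<Omega>" "f \<in> SEM \<Omega>"
  shows "stem_fun \<Omega> f (stem f)"
  using SEM_D[OF assms(2)] SEM_cosparse[OF assms(2,1)] holomorphic_stem_of slice_function_on_stem_of
  unfolding stem_fun_def by metis

lemma stem_fun_induced_pfun:
  assumes "open W" "circular W" "W \<subseteq> \<Omega>" "symmetric_stem S" "holomorphic_stem S (slice_dom W)"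
    "eventually (\<lambda>z. z \<in> slice_dom W) (cosparse (slice_dom \<Omega>))"
  shows "stem_fun \<Omega> (induced_pfun W S) S"
  using assms induced_pfun_value[OF assms(2,4)] unfolding stem_fun_def by simp

text \<open>The common part of the proofs that binary operations preserve \<open>stem_fun\<close>; the unary ones are treated
with \<open>B = A\<close>.\<close>

lemma stem_fun_combine:
  assumes A: "stem_fun \<Omega> A S" and B: "stem_fun \<Omega> B T"
    and C: "dom C = dom A \<inter> dom B" "holomorphic_stem R (slice_dom (dom A \<inter> dom B))"
      "\<And>I z. I \<in> imag_units \<Longrightarrow> z \<in> slice_dom (dom A \<inter> dom B) \<Longrightarrow>
        slice_pt I z \<in> dom A \<inter> dom B \<Longrightarrow>
        (\<And>J. J \<in> imag_units \<Longrightarrow> the (A (slice_pt J z)) = slice_val J (S z)) \<Longrightarrow>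
        (\<And>J. J \<in> imag_units \<Longrightarrow> the (B (slice_pt J z)) = slice_val J (T z)) \<Longrightarrow>
        the (C (slice_pt I z)) = slice_val I (R z)"
  shows "stem_fun \<Omega> C R"
proof -
  have circ: "circular (dom A \<inter> dom B)"
    using A B circular_Int unfolding stem_fun_def by blast
  have "eventually (\<lambda>z. z \<in> slice_dom (dom A \<inter> dom B)) (cosparse (slice_dom \<Omega>))"
    using A B unfolding stem_fun_def slice_dom_Int by (simp add: eventually_conj_iff)
  moreover have "the (C (slice_pt I z)) = slice_val I (R z)"
    if I: "I \<in> imag_units" and z: "z \<in> slice_dom (dom A \<inter> dom B)" for I z
  proof (rule C(3)[OF I z])
    show "slice_pt I z \<in> dom A \<inter> dom B"
      using circular_slice_pt_iff[OF circ I] z by simp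
  qed (use A B z in \<open>simp_all add: stem_fun_def slice_dom_Int\<close>)
  ultimately show ?thesis
    using A B C(1,2) circ unfolding stem_fun_def by auto
qed

lemma holomorphic_stem_subset:
  "holomorphic_stem S A \<Longrightarrow> B \<subseteq> A \<Longrightarrow> holomorphic_stem S B"
  unfolding holomorphic_stem_def by (meson holomorphic_on_subset)

lemma holomorphic_stem_Int:
  assumes "stem_fun \<Omega> A S" "stem_fun \<Omega> B T"
  shows "holomorphic_stem S (slice_dom (dom A \<inter> dom B))" "holomorphic_stem T (slice_dom (dom A \<inter> dom B))"
  using assms unfolding stem_fun_def slice_dom_Int by (auto elim!: holomorphic_stem_subset)

lemma holomorphic_stem_add:
  "holomorphic_stem S A \<Longrightarrow> holomorphic_stem T A \<Longrightarrow> holomorphic_stem (\<lambda>z. S z + T z) A"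
  unfolding holomorphic_stem_def biquat_sel by (auto intro!: holomorphic_intros)

lemma holomorphic_stem_diff:
  "holomorphic_stem S A \<Longrightarrow> holomorphic_stem T A \<Longrightarrow> holomorphic_stem (\<lambda>z. S z - T z) A"
  unfolding holomorphic_stem_def biquat_sel by (auto intro!: holomorphic_intros)

lemma holomorphic_stem_mult:
  "holomorphic_stem S A \<Longrightarrow> holomorphic_stem T A \<Longrightarrow> holomorphic_stem (\<lambda>z. S z * T z) A"
  unfolding holomorphic_stem_def biquat_times_sel by (auto intro!: holomorphic_intros)

lemma meromorphic_stem_mult:
  "meromorphic_stem S A \<Longrightarrow> meromorphic_stem T A \<Longrightarrow> meromorphic_stem (\<lambda>z. S z * T z) A"
  unfolding meromorphic_stem_def biquat_times_sel
  by (auto intro!: meromorphic_on_add meromorphic_on_diff meromorphic_on_mult)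

lemma holomorphic_stem_const: "holomorphic_stem (\<lambda>_. c) A"
  unfolding holomorphic_stem_def by simp

lemma stem_fun_add:
  assumes "stem_fun \<Omega> A S" "stem_fun \<Omega> B T"
  shows "stem_fun \<Omega> (A +\<^sub>s B) (\<lambda>z. S z + T z)"
proof (rule stem_fun_combine[OF assms])
  show "dom (A +\<^sub>s B) = dom A \<inter> dom B"
    by (auto simp: sem_add_def split: if_splits)
qed (auto simp: sem_add_def slice_val_simps intro: holomorphic_stem_add holomorphic_stem_Int assms)

lemma stem_fun_diff:
  assumes "stem_fun \<Omega> A S" "stem_fun \<Omega> B T"
  shows "stem_fun \<Omega> (A -\<^sub>s B) (\<lambda>z. S z - T z)"
proof (rule stem_fun_combine[OF assms])
  show "dom (A -\<^sub>s B) = dom A \<inter> dom B"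
    by (auto simp: sem_diff_def split: if_splits)
qed (auto simp: sem_diff_def slice_val_simps intro: holomorphic_stem_diff holomorphic_stem_Int assms)

lemma stem_fun_star:
  assumes "stem_fun \<Omega> A S" "stem_fun \<Omega> B T"
  shows "stem_fun \<Omega> (A \<star> B) (\<lambda>z. S z * T z)"
proof (rule stem_fun_combine[OF assms])
  show "dom (A \<star> B) = dom A \<inter> dom B"
    by (auto simp: sem_star_def split: if_splits)
  show "holomorphic_stem (\<lambda>z. S z * T z) (slice_dom (dom A \<inter> dom B))"
    by (intro holomorphic_stem_mult holomorphic_stem_Int[OF assms])
  fix I z
  assume I: "I \<in> imag_units" and z: "slice_pt I z \<in> dom A \<inter> dom B"
    and A: "\<And>J. J \<in> imag_units \<Longrightarrow> the (A (slice_pt J z)) = slice_val J (S z)"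
    and B: "\<And>J. J \<in> imag_units \<Longrightarrow> the (B (slice_pt J z)) = slice_val J (T z)"
  have "star_prod (\<lambda>p. the (A p)) (\<lambda>p. the (B p)) (slice_pt I z) = slice_val I (S z * T z)"
    using A[OF I] B by (rule star_prod_slice_val[OF I])
  then show "the ((A \<star> B) (slice_pt I z)) = slice_val I (S z * T z)"
    using z by (simp add: sem_star_def)
qed

lemma stem_fun_scale:
  assumes "stem_fun \<Omega> A S"
  shows "stem_fun \<Omega> (sem_scale r A) (\<lambda>z. bscal (of_real r) * S z)"
proof (rule stem_fun_combine[OF assms assms])
  show "dom (sem_scale r A) = dom A \<inter> dom A"
    by (auto simp: sem_scale_def)
  show "holomorphic_stem (\<lambda>z. bscal (of_real r) * S z) (slice_dom (dom A \<inter> dom A))"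
    by (intro holomorphic_stem_mult holomorphic_stem_const holomorphic_stem_Int[OF assms assms])
  fix I z
  assume I: "I \<in> imag_units" and z: "slice_pt I z \<in> dom A \<inter> dom A"
    and A: "\<And>J. J \<in> imag_units \<Longrightarrow> the (A (slice_pt J z)) = slice_val J (S z)"
  have "slice_val I (bscal (of_real r) * S z) = r *\<^sub>R slice_val I (S z)"
    unfolding slice_val_bscal_mult[OF I]
    by (simp add: slice_val_def quat_eq_iff quat_times_sel algebra_simps)
  then show "the (sem_scale r A (slice_pt I z)) = slice_val I (bscal (of_real r) * S z)"
    using z A[OF I] by (auto simp: sem_scale_def)
qed

lemma stem_fun_uminus:
  assumes "stem_fun \<Omega> A S"
  shows "stem_fun \<Omega> (-\<^sub>s A) (\<lambda>z. - S z)"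
proof (rule stem_fun_combine[OF assms assms])
  show "dom (-\<^sub>s A) = dom A \<inter> dom A"
    by (auto simp: sem_uminus_def)
  have "holomorphic_stem (\<lambda>z. 0 - S z) (slice_dom (dom A \<inter> dom A))"
    by (intro holomorphic_stem_diff holomorphic_stem_const holomorphic_stem_Int[OF assms assms])
  then show "holomorphic_stem (\<lambda>z. - S z) (slice_dom (dom A \<inter> dom A))"
    by simp
  fix I z
  assume I: "I \<in> imag_units" and z: "slice_pt I z \<in> dom A \<inter> dom A"
    and A: "\<And>J. J \<in> imag_units \<Longrightarrow> the (A (slice_pt J z)) = slice_val J (S z)"
  show "the ((-\<^sub>s A) (slice_pt I z)) = slice_val I (- S z)"
    using z A[OF I] by (auto simp: sem_uminus_def slice_val_simps)
qed

lemma stem_fun_const: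
  assumes "open \<Omega>" "circular \<Omega>"
  shows "stem_fun \<Omega> (sem_const \<Omega> c) (\<lambda>_. bquat c)"
proof -
  have d: "dom (sem_const \<Omega> c) = \<Omega>"
    by (auto simp: sem_const_def split: if_splits)
  have "eventually (\<lambda>z. z \<in> slice_dom \<Omega>) (cosparse (slice_dom \<Omega>))"
    by (rule eventually_in_cosparse) (use open_slice_dom assms in auto)
  then show ?thesis
    using assms holomorphic_stem_const circular_slice_pt_iff[OF assms(2)]
    unfolding stem_fun_def d by (auto simp: sem_const_def slice_val_simps)
qed

text \<open>The identity principle. The relation \<open>=\<^sub>s\<close> only speaks about the intersection of the two domains and
is not transitive on arbitrary partial functions. Here the domains omit only isolated parameters, so
the common domain is dense, and by continuity of the stems an equality that fails at most at
isolated points holds on all of the common domain. The right-hand side is independent of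
the domains, which makes the relation compatible with further operations.\<close>

lemma sem_eq_iff_stem:
  assumes \<Omega>: "open \<Omega>" and A: "stem_fun \<Omega> A S" and B: "stem_fun \<Omega> B T"
  shows "A =\<^sub>s B \<longleftrightarrow> eventually (\<lambda>z. S z = T z) (cosparse (slice_dom \<Omega>))"
proof -
  let ?E = "slice_dom (dom A \<inter> dom B)"
  have op: "open ?E" and circ: "circular (dom A \<inter> dom B)"
    using A B circular_Int open_slice_dom[of "dom A \<inter> dom B"] unfolding stem_fun_def by auto
  have val: "the (A (slice_pt I z)) = slice_val I (S z)" "the (B (slice_pt I z)) = slice_val I (T z)"
    if "I \<in> imag_units" "z \<in> ?E" for I z
    using A B that unfolding stem_fun_def slice_dom_Int by auto
  have in_dom: "slice_pt I z \<in> dom A \<inter> dom B" if "I \<in> imag_units" "z \<in> ?E" for I z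
    using circular_slice_pt_iff[OF circ that(1)] that(2) by simp
  show ?thesis
  proof
    assume eq: "A =\<^sub>s B"
    have "S z = T z" if z: "z \<in> ?E" for z
    proof (rule slice_val_inj[OF quat_i_imag_unit])
      have "slice_val I (S z) = slice_val I (T z)" if "I \<in> imag_units" for I
        using eq val[OF that z] in_dom[OF that z] unfolding sem_eq_def by metis
      then show "slice_val quat_i (S z) = slice_val quat_i (T z)"
        "slice_val (- quat_i) (S z) = slice_val (- quat_i) (T z)"
        using imag_units_uminus by auto
    qed
    moreover have "eventually (\<lambda>z. z \<in> ?E) (cosparse (slice_dom \<Omega>))"
      using A B unfolding stem_fun_def slice_dom_Int by (simp add: eventually_conj_iff)
    ultimately show "eventually (\<lambda>z. S z = T z) (cosparse (slice_dom \<Omega>))"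
      by (auto elim: eventually_mono)
  next
    assume ev: "eventually (\<lambda>z. S z = T z) (cosparse (slice_dom \<Omega>))"
    have ST: "S z = T z" if z: "z \<in> ?E" for z
    proof -
      have "?E \<subseteq> slice_dom \<Omega>"
        using A unfolding stem_fun_def slice_dom_def by auto
      then have evz: "eventually (\<lambda>z. S z = T z) (at z)"
        using z by (intro eventually_cosparse_imp_eventually_at[OF ev]) blast
      have "s (S z) = s (T z)" if "(\<lambda>z. s (S z)) holomorphic_on ?E" "(\<lambda>z. s (T z)) holomorphic_on ?E"
        for s :: "biquat \<Rightarrow> complex"
      proof -
        have "isCont (\<lambda>z. s (S z)) z" "isCont (\<lambda>z. s (T z)) z"
          using that z op by (meson continuous_on_eq_continuous_at holomorphic_on_imp_continuous_on)+
        then have "(\<lambda>z. s (S z)) \<midarrow>z\<rightarrow> s (S z)" "(\<lambda>z. s (T z)) \<midarrow>z\<rightarrow> s (T z)"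
          by (simp_all add: isCont_def)
        moreover have "eventually (\<lambda>z. s (S z) = s (T z)) (at z)"
          using evz by (auto elim: eventually_mono)
        ultimately show ?thesis
          using Lim_transform_eventually tendsto_unique trivial_limit_at by metis
      qed
      then show ?thesis
        using holomorphic_stem_Int[OF A B] unfolding holomorphic_stem_def biquat_eq_iff by blast
    qed
    have "A q = B q" if q: "q \<in> dom A \<inter> dom B" for q
    proof -
      obtain I where I: "I \<in> imag_units" "slice_pt I (half_plane_pt q) = q"
        using slice_pt_half_plane_pt .
      have z: "half_plane_pt q \<in> ?E"
        using circular_mem_iff[OF circ] q by blast
      have "the (A q) = the (B q)"
        using val[OF I(1) z] ST[OF z] I(2) by simp
      then show ?thesis
        using q by (auto simp: dom_def)
    qed
    then show "A =\<^sub>s B"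
      by (simp add: sem_eq_def)
  qed
qed


section \<open>Slice preserving functions and coordinates\<close>

lemma slice_plane_eq: "slice_plane I = range (slice_pt I)"
proof -
  have "of_real x + I * of_real y \<in> range (slice_pt I)" for x y
    by (rule image_eqI[of _ _ "Complex x y"]) (simp_all add: slice_pt_def)
  then show ?thesis
    by (auto simp: slice_plane_def slice_pt_def)
qed

text \<open>The values at \<open>slice_pt I z\<close> and \<open>slice_pt (- I) z\<close> both lie in the plane of \<open>I\<close>. For \<open>I = i\<close> and
\<open>I = j\<close> this kills every coordinate of the stem except the real one.\<close>

lemma slice_preserving_iff:
  assumes A: "stem_fun \<Omega> A S"
  shows "slice_preserving A \<longleftrightarrow> (\<forall>z\<in>slice_dom (dom A). S z = bscal (bq0 (S z)))"
proof -
  have circ: "circular (dom A)"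
    and val: "\<And>I z. I \<in> imag_units \<Longrightarrow> z \<in> slice_dom (dom A) \<Longrightarrow> the (A (slice_pt I z)) = slice_val I (S z)"
    using A unfolding stem_fun_def by auto
  show ?thesis
  proof (intro iffI ballI)
    fix z assume pres: "slice_preserving A" and z: "z \<in> slice_dom (dom A)"
    have mem: "slice_val I (S z) \<in> slice_plane I" if I: "I \<in> imag_units" for I
    proof -
      have "slice_pt I z \<in> dom A \<inter> slice_plane I"
        using circular_slice_pt_iff[OF circ I] z by (simp add: slice_plane_eq)
      then show ?thesis
        using pres I val[OF I z] unfolding slice_preserving_def by metis
    qed
    have j: "quat_j \<in> imag_units"
      by (simp add: imag_units_iff quat_j_def)
    have i2: "qIm2 q = 0 \<and> qIm3 q = 0" if "q \<in> slice_plane quat_i \<or> q \<in> slice_plane (- quat_i)" for q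
      using that by (auto simp: slice_plane_def quat_times_sel quat_i_def)
    have j2: "qIm1 q = 0 \<and> qIm3 q = 0" if "q \<in> slice_plane quat_j \<or> q \<in> slice_plane (- quat_j)" for q
      using that by (auto simp: slice_plane_def quat_times_sel quat_j_def)
    have "qIm2 (slice_val quat_i (S z)) = 0 \<and> qIm3 (slice_val quat_i (S z)) = 0"
      "qIm2 (slice_val (- quat_i) (S z)) = 0 \<and> qIm3 (slice_val (- quat_i) (S z)) = 0"
      "qIm1 (slice_val quat_j (S z)) = 0 \<and> qIm3 (slice_val quat_j (S z)) = 0"
      "qIm1 (slice_val (- quat_j) (S z)) = 0 \<and> qIm3 (slice_val (- quat_j) (S z)) = 0"
      using i2 j2 mem quat_i_imag_unit j imag_units_uminus by blast+
    then show "S z = bscal (bq0 (S z))"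
      by (simp add: slice_val_def quat_times_sel quat_i_def quat_j_def biquat_eq_iff complex_eq_iff)
  next
    assume r: "\<forall>z\<in>slice_dom (dom A). S z = bscal (bq0 (S z))"
    show "slice_preserving A"
      unfolding slice_preserving_def
    proof (intro ballI)
      fix I q assume I: "I \<in> imag_units" and q: "q \<in> dom A \<inter> slice_plane I"
      then obtain z where z: "q = slice_pt I z"
        by (auto simp: slice_plane_eq)
      then have zA: "z \<in> slice_dom (dom A)"
        using q circular_slice_pt_iff[OF circ I] by auto
      have "the (A q) = slice_val I (bscal (bq0 (S z)))"
        using val[OF I zA] r zA z by metis
      then show "the (A q) \<in> slice_plane I"
        by (simp add: slice_val_bscal slice_plane_eq)
    qed
  qed
qed

definition vec_sum :: "quat set \<Rightarrow> pfun \<Rightarrow> pfun \<Rightarrow> pfun \<Rightarrow> pfun" where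
  "vec_sum \<Omega> f1 f2 f3 =
     f1 \<star> sem_const \<Omega> quat_i +\<^sub>s f2 \<star> sem_const \<Omega> quat_j +\<^sub>s f3 \<star> sem_const \<Omega> quat_k"

lemma stem_fun_vec_sum:
  assumes \<Omega>: "open \<Omega>" "circular \<Omega>"
    and f: "stem_fun \<Omega> f1 S1" "stem_fun \<Omega> f2 S2" "stem_fun \<Omega> f3 S3"
  shows "stem_fun \<Omega> (vec_sum \<Omega> f1 f2 f3)
    (\<lambda>z. S1 z * bquat quat_i + S2 z * bquat quat_j + S3 z * bquat quat_k)"
  unfolding vec_sum_def by (intro stem_fun_add stem_fun_star stem_fun_const \<Omega> f)

lemma bscal_coords:
  "bscal c1 * bquat quat_i + bscal c2 * bquat quat_j + bscal c3 * bquat quat_k = Biquat 0 c1 c2 c3"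
  by (simp add: biquat_eq_iff biquat_times_sel quat_i_def quat_j_def quat_k_def)

text \<open>The conjugate is defined by a choice of coordinates, so it is meaningful only where coordinates exist.
They are induced by the coordinates of a stem; the stem \<open>S\<close> need agree with that of \<open>A\<close> only
off isolated points, as \<open>A\<close> may itself be defined through a choice of coordinates.\<close>

lemma sem_coords_exist:
  assumes \<Omega>: "open \<Omega>" "circular \<Omega>" and A: "stem_fun \<Omega> A T"
    and W: "open W" "circular W" "W \<subseteq> \<Omega>" "eventually (\<lambda>z. z \<in> slice_dom W) (cosparse (slice_dom \<Omega>))"
    and S: "symmetric_stem S" "holomorphic_stem S (slice_dom W)" "meromorphic_stem S (slice_dom \<Omega>)"
    and T: "eventually (\<lambda>z. T z = S z) (cosparse (slice_dom \<Omega>))"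
  shows "\<exists>c. sem_coords \<Omega> A c"
proof -
  have *: "induced_pfun W (\<lambda>z. bscal (s (S z))) \<in> SEMR \<Omega> \<and>
      stem_fun \<Omega> (induced_pfun W (\<lambda>z. bscal (s (S z)))) (\<lambda>z. bscal (s (S z)))"
    if "(\<lambda>z. s (S z)) holomorphic_on slice_dom W" "(\<lambda>z. s (S z)) meromorphic_on slice_dom \<Omega>"
      "\<And>a. s (bcnj a) = cnj (s a)" for s :: "biquat \<Rightarrow> complex"
  proof -
    have sym: "symmetric_stem (\<lambda>z. bscal (s (S z)))"
      using S(1) that(3) by (simp add: symmetric_stem_def)
    have hol: "holomorphic_stem (\<lambda>z. bscal (s (S z))) (slice_dom W)"
      using that(1) by (simp add: holomorphic_stem_def)
    have mer: "meromorphic_stem (\<lambda>z. bscal (s (S z))) (slice_dom \<Omega>)"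
      using that(2) by (simp add: meromorphic_stem_def meromorphic_on_const)
    have st: "stem_fun \<Omega> (induced_pfun W (\<lambda>z. bscal (s (S z)))) (\<lambda>z. bscal (s (S z)))"
      using stem_fun_induced_pfun[OF W(1-3) sym hol W(4)] .
    then show ?thesis
      using induced_pfun_SEM[OF \<Omega> W(1-3) sym hol mer W(4)] slice_preserving_iff[OF st]
      by (simp add: SEMR_def)
  qed
  note c0 = *[of bq0] and c1 = *[of bq1] and c2 = *[of bq2] and c3 = *[of bq3]
  define f where "f s = induced_pfun W (\<lambda>z. bscal (s (S z)))" for s
  have R: "f bq0 \<in> SEMR \<Omega>" "f bq1 \<in> SEMR \<Omega>" "f bq2 \<in> SEMR \<Omega>" "f bq3 \<in> SEMR \<Omega>"
    and st: "stem_fun \<Omega> (f bq0) (\<lambda>z. bscal (bq0 (S z)))" "stem_fun \<Omega> (f bq1) (\<lambda>z. bscal (bq1 (S z)))"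
      "stem_fun \<Omega> (f bq2) (\<lambda>z. bscal (bq2 (S z)))" "stem_fun \<Omega> (f bq3) (\<lambda>z. bscal (bq3 (S z)))"
    using S(2,3) c0 c1 c2 c3 unfolding f_def holomorphic_stem_def meromorphic_stem_def by auto
  have "stem_fun \<Omega> (f bq0 +\<^sub>s vec_sum \<Omega> (f bq1) (f bq2) (f bq3))
      (\<lambda>z. bscal (bq0 (S z)) + Biquat 0 (bq1 (S z)) (bq2 (S z)) (bq3 (S z)))"
    using stem_fun_add[OF st(1) stem_fun_vec_sum[OF \<Omega> st(2,3,4)]] unfolding bscal_coords .
  moreover have "bscal (bq0 a) + Biquat 0 (bq1 a) (bq2 a) (bq3 a) = a" for a
    by (simp add: biquat_eq_iff)
  ultimately have "stem_fun \<Omega> (f bq0 +\<^sub>s vec_sum \<Omega> (f bq1) (f bq2) (f bq3)) S"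
    by simp
  then have "A =\<^sub>s f bq0 +\<^sub>s vec_sum \<Omega> (f bq1) (f bq2) (f bq3)"
    using sem_eq_iff_stem[OF \<Omega>(1) A] T by blast
  then have "sem_coords \<Omega> A (f bq0, f bq1, f bq2, f bq3)"
    using R by (simp add: sem_coords_def vec_sum_def)
  then show ?thesis
    by blast
qed

text \<open>Whatever coordinates are chosen, off isolated points they are the coordinates of the stem, hence
the stem of the conjugate is known there. Its domain is not that of the function, but depends on
the choice.\<close>

lemma stem_fun_sem_conj:
  assumes \<Omega>: "open \<Omega>" "circular \<Omega>" and A: "stem_fun \<Omega> A S" and ex: "\<exists>c. sem_coords \<Omega> A c"
  obtains C where "stem_fun \<Omega> (sem_conj \<Omega> A) C"
    "eventually (\<lambda>z. C z = bconj (S z)) (cosparse (slice_dom \<Omega>))"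
proof -
  obtain f0 f1 f2 f3 where c: "(SOME c. sem_coords \<Omega> A c) = (f0, f1, f2, f3)"
    by (metis prod.exhaust)
  then have "sem_coords \<Omega> A (f0, f1, f2, f3)"
    using someI_ex[OF ex] by simp
  then have R: "f0 \<in> SEMR \<Omega>" "f1 \<in> SEMR \<Omega>" "f2 \<in> SEMR \<Omega>" "f3 \<in> SEMR \<Omega>"
    and eq: "A =\<^sub>s f0 +\<^sub>s vec_sum \<Omega> f1 f2 f3"
    by (simp_all add: sem_coords_def vec_sum_def)
  have conj: "sem_conj \<Omega> A = f0 -\<^sub>s vec_sum \<Omega> f1 f2 f3"
    by (simp add: sem_conj_def c vec_sum_def)
  have st: "stem_fun \<Omega> f (stem f)" if "f \<in> SEMR \<Omega>" for f
    using that stem_fun_SEM[OF \<Omega>(1)] by (simp add: SEMR_def)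
  have real: "eventually (\<lambda>z. stem f z = bscal (bq0 (stem f z))) (cosparse (slice_dom \<Omega>))"
    if "f \<in> SEMR \<Omega>" for f
    using st[OF that] that slice_preserving_iff[OF st[OF that]]
    unfolding SEMR_def stem_fun_def by (auto elim: eventually_mono)
  note vs = stem_fun_vec_sum[OF \<Omega> st[OF R(2)] st[OF R(3)] st[OF R(4)]]
  have ev: "eventually (\<lambda>z. S z = stem f0 z + (stem f1 z * bquat quat_i + stem f2 z * bquat quat_j
      + stem f3 z * bquat quat_k)) (cosparse (slice_dom \<Omega>))"
    using sem_eq_iff_stem[OF \<Omega>(1) A stem_fun_add[OF st[OF R(1)] vs]] eq by blast
  have "stem_fun \<Omega> (sem_conj \<Omega> A) (\<lambda>z. stem f0 z - (stem f1 z * bquat quat_i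
      + stem f2 z * bquat quat_j + stem f3 z * bquat quat_k))"
    unfolding conj by (intro stem_fun_diff st R vs)
  moreover have "eventually (\<lambda>z. stem f0 z - (stem f1 z * bquat quat_i
      + stem f2 z * bquat quat_j + stem f3 z * bquat quat_k) = bconj (S z)) (cosparse (slice_dom \<Omega>))"
    using ev real[OF R(1)] real[OF R(2)] real[OF R(3)] real[OF R(4)]
  proof eventually_elim
    case (elim z)
    obtain c0 c1 c2 c3 where c: "stem f0 z = bscal c0" "stem f1 z = bscal c1" "stem f2 z = bscal c2"
      "stem f3 z = bscal c3"
      using elim(2-5) by blast
    show ?case
      using elim(1) unfolding c bscal_coords by (simp add: biquat_eq_iff)
  qed
  ultimately show ?thesis
    using that by blast
qed

section \<open>Zeros of stem components\<close>

text \<open>The parameter set of a domain that misses the real axis has two components, so the usual argument by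
connectedness is carried out in \<open>\<Omega>\<close> itself: the parameters near which \<open>g\<close> vanishes, and those near
which it does not, form two open sets, and their preimages under \<open>half_plane_pt\<close> split \<open>\<Omega>\<close>. The
conjugation symmetry of \<open>g\<close> transfers the result to the lower half plane.\<close>

lemma meromorphic_zero_dichotomy:
  assumes \<Omega>: "circular_domain \<Omega>" and g: "g meromorphic_on slice_dom \<Omega>"
    and sym: "\<And>z. g (cnj z) = cnj (g z)"
  shows "eventually (\<lambda>z. g z = 0) (cosparse (slice_dom \<Omega>)) \<or>
    eventually (\<lambda>z. g z \<noteq> 0) (cosparse (slice_dom \<Omega>))"
proof -
  have op: "open \<Omega>" and circ: "circular \<Omega>" and conn: "connected \<Omega>"
    using \<Omega> by (auto simp: circular_domain_def)
  have opD: "open (slice_dom \<Omega>)"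
    using op open_slice_dom by blast
  define D where "D P = {z\<in>slice_dom \<Omega>. eventually P (at z)}" for P
  have open_D: "open (D P)" for P
  proof (rule openI)
    fix z assume "z \<in> D P"
    then obtain B where B: "open B" "z \<in> B" "\<forall>w\<in>B. w \<noteq> z \<longrightarrow> P w" and z: "z \<in> slice_dom \<Omega>"
      by (auto simp: D_def eventually_at_topological)
    have "w \<in> D P" if w: "w \<in> B \<inter> slice_dom \<Omega>" for w
    proof (cases "w = z")
      case False
      have "eventually (\<lambda>u. u \<in> B - {z}) (at w)"
        using B(1) w False by (intro eventually_at_in_open') auto
      then show ?thesis
        using w B(3) by (auto simp: D_def elim: eventually_mono)
    qed (use \<open>z \<in> D P\<close> in simp)
    then show "\<exists>e>0. ball z e \<subseteq> D P"
      using B(1,2) z opD by (meson IntI open_Int open_contains_ball subset_eq)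
  qed
  let ?Z = "D (\<lambda>w. g w = 0)" and ?N = "D (\<lambda>w. g w \<noteq> 0)"
  have cover: "z \<in> ?Z \<or> z \<in> ?N" if "z \<in> slice_dom \<Omega>" for z
  proof (cases "frequently (\<lambda>w. g w = 0) (at z)")
    case True
    then have "eventually (\<lambda>w. g w = 0) (at z)"
      using g that not_essential_frequently_0_imp_eventually_0[of g z]
      unfolding meromorphic_on_altdef by blast
    then show ?thesis
      using that by (simp add: D_def)
  next
    case False
    then show ?thesis
      using that by (simp add: D_def not_frequently)
  qed
  have disj: "\<not> (z \<in> ?Z \<and> z \<in> ?N)" for z
  proof
    assume "z \<in> ?Z \<and> z \<in> ?N"
    then have "eventually (\<lambda>w. g w = 0) (at z)" "eventually (\<lambda>w. g w \<noteq> 0) (at z)"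
      by (simp_all add: D_def)
    then have "eventually (\<lambda>_. False) (at z)"
      by eventually_elim simp
    then show False
      by simp
  qed
  have all: "eventually P (cosparse (slice_dom \<Omega>))"
    if P: "\<And>q. q \<in> \<Omega> \<Longrightarrow> half_plane_pt q \<in> D P" "\<And>w. P (cnj w) \<longleftrightarrow> P w" for P
    unfolding eventually_cosparse_open_eq[OF opD]
  proof
    fix z assume z: "z \<in> slice_dom \<Omega>"
    then have "Complex (Re z) \<bar>Im z\<bar> \<in> D P"
      using P(1)[of "slice_pt quat_i z"] by (simp add: half_plane_pt_slice_pt slice_dom_def)
    then have "eventually P (at z) \<or> eventually P (at (cnj z))"
      using half_plane_pt_cases[of z] by (auto simp: D_def)
    then show "eventually P (at z)"
      using eventually_at_cnj[of P z] P(2) by auto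
  qed
  have "half_plane_pt -` ?Z \<inter> \<Omega> = {} \<or> half_plane_pt -` ?N \<inter> \<Omega> = {}"
  proof (rule connectedD[OF conn])
    show "open (half_plane_pt -` ?Z)" "open (half_plane_pt -` ?N)"
      by (intro open_vimage_half_plane_pt open_D)+
    show "half_plane_pt -` ?Z \<inter> half_plane_pt -` ?N \<inter> \<Omega> = {}"
      using disj by auto
    show "\<Omega> \<subseteq> half_plane_pt -` ?Z \<union> half_plane_pt -` ?N"
      using cover circular_mem_iff[OF circ] by blast
  qed
  then show ?thesis
  proof
    assume "half_plane_pt -` ?Z \<inter> \<Omega> = {}"
    then have "half_plane_pt q \<in> ?N" if "q \<in> \<Omega>" for q
      using that cover circular_mem_iff[OF circ] by blast
    then show ?thesis
      using all[of "\<lambda>w. g w \<noteq> 0"] sym by auto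
  next
    assume "half_plane_pt -` ?N \<inter> \<Omega> = {}"
    then have "half_plane_pt q \<in> ?Z" if "q \<in> \<Omega>" for q
      using that cover circular_mem_iff[OF circ] by blast
    then show ?thesis
      using all[of "\<lambda>w. g w = 0"] sym by auto
  qed
qed

section \<open>The Sylvester equation over the complex quaternions\<close>

lemma bconj_mult_self: "bconj a * a = bscal ((bq0 a)\<^sup>2 + (bq1 a)\<^sup>2 + (bq2 a)\<^sup>2 + (bq3 a)\<^sup>2)"
  by (simp add: biquat_eq_iff biquat_times_sel power2_eq_square)

lemma bconj_add_self: "bconj a + a = bscal (2 * bq0 a)"
  by (simp add: biquat_eq_iff)

lemma bvec_mult_bconj: "bvec a * bconj (bvec a) = bscal ((bq1 a)\<^sup>2 + (bq2 a)\<^sup>2 + (bq3 a)\<^sup>2)"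
  by (simp add: biquat_eq_iff biquat_times_sel power2_eq_square)

text \<open>The hypotheses say that \<open>a\<close> and \<open>- c\<close> have the same trace and \<open>a\<close> and \<open>c\<close> the same norm. Both are
central, so the expression equals \<open>x (n - t c + c\<^sup>2)\<close> with \<open>t\<close> and \<open>n\<close> the trace and the norm of
\<open>c\<close>, and this vanishes by the characteristic equation of \<open>c\<close>.\<close>

lemma sylvester_necessary:
  assumes re: "bq0 a = - bq0 c"
    and vec: "(bq1 a)\<^sup>2 + (bq2 a)\<^sup>2 + (bq3 a)\<^sup>2 = (bq1 c)\<^sup>2 + (bq2 c)\<^sup>2 + (bq3 c)\<^sup>2"
  shows "bconj a * (a * x + x * c) + (a * x + x * c) * c = 0"
proof -
  have "bscal ((bq0 a)\<^sup>2 + (bq1 a)\<^sup>2 + (bq2 a)\<^sup>2 + (bq3 a)\<^sup>2)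
      = bscal ((bq0 c)\<^sup>2 + (bq1 c)\<^sup>2 + (bq2 c)\<^sup>2 + (bq3 c)\<^sup>2)"
    using re vec by (simp add: add.assoc)
  then have n: "bconj a * a = bconj c * c"
    by (simp add: bconj_mult_self)
  have t: "bconj a + a = - (bconj c + c)"
    by (simp add: bconj_add_self re biquat_eq_iff)
  have cen: "bconj c * c * x = x * (bconj c * c)" "(bconj c + c) * x = x * (bconj c + c)"
    by (simp_all add: bconj_mult_self bconj_add_self bscal_central)
  have "bconj a * (a * x + x * c) + (a * x + x * c) * c
      = bconj a * a * x + (bconj a + a) * x * c + x * c * c"
    by (simp add: algebra_simps)
  also have "\<dots> = bconj c * c * x - (bconj c + c) * x * c + x * c * c"
    unfolding n t by (simp add: algebra_simps)
  also have "\<dots> = x * (bconj c * c) - x * (bconj c + c) * c + x * c * c"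
    by (simp only: cen)
  also have "\<dots> = 0"
    by (simp add: algebra_simps)
  finally show ?thesis .
qed

text \<open>The central parts of \<open>a\<close> and \<open>c\<close> cancel. What is left of the condition on \<open>b\<close> is
\<open>bvec a * b = b * bvec c\<close>, by which the factor \<open>bvec c\<close> on the far right of \<open>u * b * bvec c\<close> moves to
the left of \<open>b\<close>.\<close>

lemma sylvester_sufficient:
  assumes re: "bq0 a = - bq0 c" and b: "bconj a * b + b * c = 0"
    and u: "bvec a * u + u * bvec a = 1"
  shows "a * (u * b) + u * b * c = b"
proof -
  have a: "a = bscal (bq0 a) + bvec a" "bconj a = bscal (bq0 a) - bvec a"
    and c: "c = bvec c - bscal (bq0 a)"
    using re by (simp_all add: biquat_eq_iff)
  have comm: "bvec a * b = b * bvec c"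
  proof -
    have "bconj a * b + b * c = b * bvec c - bvec a * b"
      by (subst a(2), subst c) (simp add: algebra_simps bscal_central)
    then show ?thesis
      using b by simp
  qed
  have "a * (u * b) + u * b * c = bvec a * u * b + u * (b * bvec c)"
    by (subst a(1), subst c) (simp add: algebra_simps bscal_central[of _ "u * b"] mult.assoc)
  also have "\<dots> = (bvec a * u + u * bvec a) * b"
    by (simp add: comm[symmetric] distrib_right mult.assoc)
  finally show ?thesis
    using u by simp
qed

text \<open>The anticommutator of two vectors is \<open>- 2\<close> times their inner product, so a unit vector reads off a
coordinate.\<close>

lemma anticommutator_unit:
  "bvec a * bquat quat_i + bquat quat_i * bvec a = bscal (- (2 * bq1 a))"
  "bvec a * bquat quat_j + bquat quat_j * bvec a = bscal (- (2 * bq2 a))"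
  "bvec a * bquat quat_k + bquat quat_k * bvec a = bscal (- (2 * bq3 a))"
  by (simp_all add: biquat_eq_iff biquat_times_sel quat_i_def quat_j_def quat_k_def)


section \<open>The equation for semi-regular functions\<close>

lemma stem_fun_parts:
  assumes \<Omega>: "open \<Omega>" "circular \<Omega>" and f: "f \<in> SEM \<Omega>"
  obtains C R Q where
    "stem_fun \<Omega> (sem_conj \<Omega> f) C" "eventually (\<lambda>z. C z = bconj (stem f z)) (cosparse (slice_dom \<Omega>))"
    "stem_fun \<Omega> (sem_re \<Omega> f) R" "eventually (\<lambda>z. R z = bscal (bq0 (stem f z))) (cosparse (slice_dom \<Omega>))"
    "stem_fun \<Omega> (sem_symm \<Omega> (sem_vec \<Omega> f)) Q"
    "eventually (\<lambda>z. Q z = bscal ((bq1 (stem f z))\<^sup>2 + (bq2 (stem f z))\<^sup>2 + (bq3 (stem f z))\<^sup>2))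
       (cosparse (slice_dom \<Omega>))"
proof -
  let ?S = "stem f"
  note sf = stem_fun_SEM[OF \<Omega>(1) f]
  note W = SEM_D(2,3,1)[OF f] SEM_cosparse[OF f \<Omega>(1)]
  have hol: "holomorphic_stem ?S (slice_dom (dom f))"
    using sf by (simp add: stem_fun_def)
  note mer = SEM_meromorphic_stem[OF f]
  have "\<exists>c. sem_coords \<Omega> f c"
    by (rule sem_coords_exist[OF \<Omega> sf W symmetric_stem_of hol mer]) simp
  from stem_fun_sem_conj[OF \<Omega> sf this] obtain C where C: "stem_fun \<Omega> (sem_conj \<Omega> f) C"
    "eventually (\<lambda>z. C z = bconj (?S z)) (cosparse (slice_dom \<Omega>))" .
  define R where "R z = bscal (of_real (1/2)) * (?S z + C z)" for z
  have R: "stem_fun \<Omega> (sem_re \<Omega> f) R"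
    unfolding sem_re_def R_def by (intro stem_fun_scale stem_fun_add sf C(1))
  have evR: "eventually (\<lambda>z. R z = bscal (bq0 (?S z))) (cosparse (slice_dom \<Omega>))"
    using C(2)
  proof eventually_elim
    case (elim z)
    show ?case
      unfolding R_def elim by (simp add: biquat_eq_iff sel_bscal_mult)
  qed
  have V: "stem_fun \<Omega> (sem_vec \<Omega> f) (\<lambda>z. ?S z - R z)"
    unfolding sem_vec_def by (intro stem_fun_diff sf R)
  have evV: "eventually (\<lambda>z. ?S z - R z = bvec (?S z)) (cosparse (slice_dom \<Omega>))"
    using evR by eventually_elim (simp add: biquat_eq_iff)
  have "\<exists>c. sem_coords \<Omega> (sem_vec \<Omega> f) c"
  proof (rule sem_coords_exist[OF \<Omega> V W _ _ _ evV])
    show "symmetric_stem (\<lambda>z. bvec (?S z))"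
      using symmetric_stem_of[of "\<lambda>q. the (f q)"] by (simp add: symmetric_stem_def biquat_eq_iff)
    show "holomorphic_stem (\<lambda>z. bvec (?S z)) (slice_dom (dom f))"
      using hol by (simp add: holomorphic_stem_def)
    show "meromorphic_stem (\<lambda>z. bvec (?S z)) (slice_dom \<Omega>)"
      using mer by (simp add: meromorphic_stem_def meromorphic_on_const)
  qed
  from stem_fun_sem_conj[OF \<Omega> V this] obtain C' where C': "stem_fun \<Omega> (sem_conj \<Omega> (sem_vec \<Omega> f)) C'"
    "eventually (\<lambda>z. C' z = bconj (?S z - R z)) (cosparse (slice_dom \<Omega>))" .
  have Q: "stem_fun \<Omega> (sem_symm \<Omega> (sem_vec \<Omega> f)) (\<lambda>z. (?S z - R z) * C' z)"
    unfolding sem_symm_def by (intro stem_fun_star V C'(1))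
  have "eventually (\<lambda>z. (?S z - R z) * C' z
      = bscal ((bq1 (?S z))\<^sup>2 + (bq2 (?S z))\<^sup>2 + (bq3 (?S z))\<^sup>2)) (cosparse (slice_dom \<Omega>))"
    using evV C'(2) by eventually_elim (simp add: bvec_mult_bconj)
  with that[OF C R evR Q] show thesis .
qed

text \<open>The stem \<open>u\<close> is the constant unit \<open>e\<close> divided by \<open>- 2 \<phi>\<close>, where \<open>\<phi>\<close> is the coordinate of the stem
of \<open>f\<close> that belongs to \<open>e\<close>. It is holomorphic where \<open>f\<close> is defined and \<open>\<phi>\<close> does not vanish, and this
omits only isolated parameters because \<open>\<phi>\<close> is not identically zero.\<close>

lemma anticommuting_inverse_unit:
  fixes s :: "biquat \<Rightarrow> complex" and e :: quat
  assumes \<Omega>: "circular_domain \<Omega>" and f: "f \<in> SEM \<Omega>"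
    and hol: "(\<lambda>z. s (stem f z)) holomorphic_on slice_dom (dom f)"
    and mer: "(\<lambda>z. s (stem f z)) meromorphic_on slice_dom \<Omega>"
    and s: "\<And>a. s (bcnj a) = cnj (s a)"
    and e: "\<And>a. bvec a * bquat e + bquat e * bvec a = bscal (- (2 * s a))"
    and nz: "z0 \<in> slice_dom (dom f)" "s (stem f z0) \<noteq> 0"
  obtains W u where "open W" "circular W" "W \<subseteq> \<Omega>" "symmetric_stem u"
    "holomorphic_stem u (slice_dom W)" "meromorphic_stem u (slice_dom \<Omega>)"
    "eventually (\<lambda>z. z \<in> slice_dom W) (cosparse (slice_dom \<Omega>))"
    "eventually (\<lambda>z. bvec (stem f z) * u z + u z * bvec (stem f z) = 1) (cosparse (slice_dom \<Omega>))"
proof -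
  define \<phi> where "\<phi> z = s (stem f z)" for z
  have op: "open \<Omega>" and circ: "circular \<Omega>"
    using \<Omega> by (auto simp: circular_domain_def)
  have opf: "open (slice_dom (dom f))" and circf: "circular (dom f)"
    using open_slice_dom SEM_D[OF f] by auto
  have sym: "\<phi> (cnj z) = cnj (\<phi> z)" for z
    using symmetric_stem_of[of "\<lambda>q. the (f q)"] s by (simp add: \<phi>_def symmetric_stem_def)
  have not0: "\<not> eventually (\<lambda>z. \<phi> z = 0) (cosparse (slice_dom \<Omega>))"
  proof
    assume "eventually (\<lambda>z. \<phi> z = 0) (cosparse (slice_dom \<Omega>))"
    moreover have "z0 \<in> slice_dom \<Omega>"
      using nz(1) SEM_D(1)[OF f] by (auto simp: slice_dom_def)
    ultimately have "eventually (\<lambda>z. \<phi> z = 0) (at z0)"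
      by (rule eventually_cosparse_imp_eventually_at)
    moreover have "isCont \<phi> z0"
      using hol opf nz(1) unfolding \<phi>_def
      by (meson continuous_on_eq_continuous_at holomorphic_on_imp_continuous_on)
    then have "\<phi> \<midarrow>z0\<rightarrow> \<phi> z0"
      by (simp add: isCont_def)
    ultimately have "(\<lambda>_. 0) \<midarrow>z0\<rightarrow> \<phi> z0"
      by (rule Lim_transform_eventually[rotated])
    then show False
      using nz(2) by (simp add: \<phi>_def tendsto_const_iff)
  qed
  have ev0: "eventually (\<lambda>z. \<phi> z \<noteq> 0) (cosparse (slice_dom \<Omega>))"
    using meromorphic_zero_dichotomy[OF \<Omega>, of \<phi>] mer sym not0 unfolding \<phi>_def by blast
  define B where "B = {z \<in> slice_dom (dom f). \<phi> z \<noteq> 0}"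
  have opB: "open B"
  proof -
    have "open {z \<in> slice_dom (dom f). \<phi> z \<in> - {0}}"
      using hol opf unfolding \<phi>_def
      by (intro continuous_open_preimage[unfolded Int_def vimage_def, simplified]
          holomorphic_on_imp_continuous_on) auto
    then show ?thesis
      by (simp add: B_def)
  qed
  have B_cnj: "cnj z \<in> B \<longleftrightarrow> z \<in> B" for z
    using slice_dom_cnj[OF circf] sym by (simp add: B_def)
  define W where "W = half_plane_pt -` B"
  have sW: "slice_dom W = B"
  proof -
    have "z \<in> slice_dom W \<longleftrightarrow> Complex (Re z) \<bar>Im z\<bar> \<in> B" for z
      by (simp add: W_def slice_dom_def half_plane_pt_slice_pt)
    then show ?thesis
      using half_plane_pt_cases B_cnj by (metis (no_types, lifting) subsetI subset_antisym)
  qed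
  define u where "u z = bscal (- 1 / (2 * \<phi> z)) * bquat e" for z
  have "open W" "circular W"
    unfolding W_def by (intro open_vimage_half_plane_pt opB circular_vimage_half_plane_pt)+
  moreover have "W \<subseteq> \<Omega>"
    using circular_mem_iff[OF circf] SEM_D(1)[OF f] by (auto simp: W_def B_def)
  moreover have "symmetric_stem u"
    by (simp add: symmetric_stem_def u_def sym)
  moreover have "holomorphic_stem u (slice_dom W)"
  proof -
    have "\<phi> holomorphic_on B"
      using hol unfolding \<phi>_def by (rule holomorphic_on_subset) (auto simp: B_def)
    then show ?thesis
      unfolding sW holomorphic_stem_def u_def sel_bscal_mult
      by (intro conjI holomorphic_intros) (auto simp: B_def)
  qed
  moreover have "meromorphic_stem u (slice_dom \<Omega>)"
    using mer unfolding meromorphic_stem_def u_def sel_bscal_mult \<phi>_def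
    by (intro conjI meromorphic_intros)
  moreover have "eventually (\<lambda>z. z \<in> slice_dom W) (cosparse (slice_dom \<Omega>))"
    using SEM_cosparse[OF f op] ev0 unfolding sW by eventually_elim (simp add: B_def)
  moreover have "eventually (\<lambda>z. bvec (stem f z) * u z + u z * bvec (stem f z) = 1)
      (cosparse (slice_dom \<Omega>))"
    using ev0
  proof eventually_elim
    case (elim z)
    let ?c = "- 1 / (2 * \<phi> z)"
    have "bvec (stem f z) * u z + u z * bvec (stem f z)
        = bscal ?c * (bvec (stem f z) * bquat e + bquat e * bvec (stem f z))"
      unfolding u_def distrib_left mult.assoc[symmetric] bscal_central[of ?c "bvec (stem f z)"] ..
    also have "\<dots> = bscal (?c * - (2 * \<phi> z))"
      unfolding e bscal_mult by (simp add: \<phi>_def)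
    also have "?c * - (2 * \<phi> z) = 1"
      using elim by simp
    finally show ?case
      by (simp add: biquat_eq_iff)
  qed
  ultimately show ?thesis
    using that by blast
qed

text \<open>A function that is not slice preserving has a vectorial coordinate that does not vanish somewhere on
its domain.\<close>

lemma anticommuting_inverse:
  assumes \<Omega>: "circular_domain \<Omega>" and f: "f \<in> SEM \<Omega> - SEMR \<Omega>"
  obtains W u where "open W" "circular W" "W \<subseteq> \<Omega>" "symmetric_stem u"
    "holomorphic_stem u (slice_dom W)" "meromorphic_stem u (slice_dom \<Omega>)"
    "eventually (\<lambda>z. z \<in> slice_dom W) (cosparse (slice_dom \<Omega>))"
    "eventually (\<lambda>z. bvec (stem f z) * u z + u z * bvec (stem f z) = 1) (cosparse (slice_dom \<Omega>))"
proof -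
  have op: "open \<Omega>"
    using \<Omega> by (auto simp: circular_domain_def)
  have f': "f \<in> SEM \<Omega>"
    using f by simp
  note sf = stem_fun_SEM[OF op f']
  have "\<not> slice_preserving f"
    using f by (simp add: SEMR_def)
  then obtain z0 where z0: "z0 \<in> slice_dom (dom f)" "stem f z0 \<noteq> bscal (bq0 (stem f z0))"
    using slice_preserving_iff[OF sf] by blast
  have hol: "holomorphic_stem (stem f) (slice_dom (dom f))"
    using sf by (simp add: stem_fun_def)
  note mer = SEM_meromorphic_stem[OF f']
  consider "bq1 (stem f z0) \<noteq> 0" | "bq2 (stem f z0) \<noteq> 0" | "bq3 (stem f z0) \<noteq> 0"
    using z0(2) by (auto simp: biquat_eq_iff)
  then show thesis
  proof cases
    case 1
    show ?thesis
      by (rule anticommuting_inverse_unit[OF \<Omega> f' _ _ _ anticommutator_unit(1) z0(1) 1])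
        (use hol mer that in \<open>simp_all add: holomorphic_stem_def meromorphic_stem_def\<close>)
  next
    case 2
    show ?thesis
      by (rule anticommuting_inverse_unit[OF \<Omega> f' _ _ _ anticommutator_unit(2) z0(1) 2])
        (use hol mer that in \<open>simp_all add: holomorphic_stem_def meromorphic_stem_def\<close>)
  next
    case 3
    show ?thesis
      by (rule anticommuting_inverse_unit[OF \<Omega> f' _ _ _ anticommutator_unit(3) z0(1) 3])
        (use hol mer that in \<open>simp_all add: holomorphic_stem_def meromorphic_stem_def\<close>)
  qed
qed

theorem proposition7p5:
  fixes \<Omega> :: "quat set" and f g b :: pfun
  assumes "circular_domain \<Omega>"
    and "f \<in> SEM \<Omega> - SEMR \<Omega>"
    and "g \<in> SEM \<Omega> - SEMR \<Omega>"
    and "sem_re \<Omega> f =\<^sub>s -\<^sub>s sem_re \<Omega> g"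
    and "sem_symm \<Omega> (sem_vec \<Omega> f) =\<^sub>s sem_symm \<Omega> (sem_vec \<Omega> g)"
    and "b \<in> SEM \<Omega>"
  shows "(\<exists>X \<in> SEM \<Omega>. f \<star> X +\<^sub>s X \<star> g =\<^sub>s b) \<longleftrightarrow>
         sem_conj \<Omega> f \<star> b +\<^sub>s b \<star> g =\<^sub>s sem_const \<Omega> 0"
proof -
  have op: "open \<Omega>" and circ: "circular \<Omega>"
    using assms(1) by (auto simp: circular_domain_def)
  have f: "f \<in> SEM \<Omega>" and g: "g \<in> SEM \<Omega>" and b: "b \<in> SEM \<Omega>"
    using assms by auto
  note sf = stem_fun_SEM[OF op f] and sg = stem_fun_SEM[OF op g] and sb = stem_fun_SEM[OF op b]
  note eq_iff = sem_eq_iff_stem[OF op]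
  obtain Cf Rf Qf where Cf: "stem_fun \<Omega> (sem_conj \<Omega> f) Cf"
      "eventually (\<lambda>z. Cf z = bconj (stem f z)) (cosparse (slice_dom \<Omega>))"
    and Rf: "stem_fun \<Omega> (sem_re \<Omega> f) Rf"
      "eventually (\<lambda>z. Rf z = bscal (bq0 (stem f z))) (cosparse (slice_dom \<Omega>))"
    and Qf: "stem_fun \<Omega> (sem_symm \<Omega> (sem_vec \<Omega> f)) Qf"
      "eventually (\<lambda>z. Qf z = bscal ((bq1 (stem f z))\<^sup>2 + (bq2 (stem f z))\<^sup>2 + (bq3 (stem f z))\<^sup>2))
         (cosparse (slice_dom \<Omega>))"
    using stem_fun_parts[OF op circ f] .
  obtain Cg Rg Qg where "stem_fun \<Omega> (sem_conj \<Omega> g) Cg"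
      "eventually (\<lambda>z. Cg z = bconj (stem g z)) (cosparse (slice_dom \<Omega>))"
    and Rg: "stem_fun \<Omega> (sem_re \<Omega> g) Rg"
      "eventually (\<lambda>z. Rg z = bscal (bq0 (stem g z))) (cosparse (slice_dom \<Omega>))"
    and Qg: "stem_fun \<Omega> (sem_symm \<Omega> (sem_vec \<Omega> g)) Qg"
      "eventually (\<lambda>z. Qg z = bscal ((bq1 (stem g z))\<^sup>2 + (bq2 (stem g z))\<^sup>2 + (bq3 (stem g z))\<^sup>2))
         (cosparse (slice_dom \<Omega>))"
    using stem_fun_parts[OF op circ g] .
  have re: "eventually (\<lambda>z. bq0 (stem f z) = - bq0 (stem g z)) (cosparse (slice_dom \<Omega>))"
    using assms(4)[unfolded eq_iff[OF Rf(1) stem_fun_uminus[OF Rg(1)]]] Rf(2) Rg(2)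
    by eventually_elim (simp add: biquat_eq_iff)
  have vec: "eventually (\<lambda>z. (bq1 (stem f z))\<^sup>2 + (bq2 (stem f z))\<^sup>2 + (bq3 (stem f z))\<^sup>2
      = (bq1 (stem g z))\<^sup>2 + (bq2 (stem g z))\<^sup>2 + (bq3 (stem g z))\<^sup>2) (cosparse (slice_dom \<Omega>))"
    using assms(5)[unfolded eq_iff[OF Qf(1) Qg(1)]] Qf(2) Qg(2)
    by eventually_elim (simp add: biquat_eq_iff)
  have eqn_iff: "f \<star> X +\<^sub>s X \<star> g =\<^sub>s b \<longleftrightarrow>
      eventually (\<lambda>z. stem f z * S z + S z * stem g z = stem b z) (cosparse (slice_dom \<Omega>))"
    if "stem_fun \<Omega> X S" for X S
    by (intro eq_iff stem_fun_add stem_fun_star sf sg sb that)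
  have "sem_conj \<Omega> f \<star> b +\<^sub>s b \<star> g =\<^sub>s sem_const \<Omega> 0 \<longleftrightarrow>
      eventually (\<lambda>z. Cf z * stem b z + stem b z * stem g z = bquat 0) (cosparse (slice_dom \<Omega>))"
    by (intro eq_iff stem_fun_add stem_fun_star stem_fun_const op circ Cf(1) sg sb)
  also have "bquat 0 = 0"
    by (simp add: biquat_eq_iff)
  also have "eventually (\<lambda>z. Cf z * stem b z + stem b z * stem g z = 0) (cosparse (slice_dom \<Omega>))
      \<longleftrightarrow> eventually (\<lambda>z. bconj (stem f z) * stem b z + stem b z * stem g z = 0) (cosparse (slice_dom \<Omega>))"
    by (rule eventually_cong[OF Cf(2)]) simp
  finally have cond_iff: "sem_conj \<Omega> f \<star> b +\<^sub>s b \<star> g =\<^sub>s sem_const \<Omega> 0 \<longleftrightarrow>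
      eventually (\<lambda>z. bconj (stem f z) * stem b z + stem b z * stem g z = 0) (cosparse (slice_dom \<Omega>))" .
  show ?thesis
    unfolding cond_iff
  proof
    assume "\<exists>X \<in> SEM \<Omega>. f \<star> X +\<^sub>s X \<star> g =\<^sub>s b"
    then obtain X where X: "X \<in> SEM \<Omega>" "f \<star> X +\<^sub>s X \<star> g =\<^sub>s b"
      by blast
    have "eventually (\<lambda>z. stem f z * stem X z + stem X z * stem g z = stem b z)
        (cosparse (slice_dom \<Omega>))"
      using X(2) eqn_iff[OF stem_fun_SEM[OF op X(1)]] by simp
    then show "eventually (\<lambda>z. bconj (stem f z) * stem b z + stem b z * stem g z = 0)
        (cosparse (slice_dom \<Omega>))"
      using re vec
    proof eventually_elim
      case (elim z)
      from sylvester_necessary[OF elim(2,3), of "stem X z"] show ?case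
        unfolding elim(1) .
    qed
  next
    assume cond: "eventually (\<lambda>z. bconj (stem f z) * stem b z + stem b z * stem g z = 0)
        (cosparse (slice_dom \<Omega>))"
    obtain W u where W: "open W" "circular W" "W \<subseteq> \<Omega>" and u: "symmetric_stem u"
      "holomorphic_stem u (slice_dom W)" "meromorphic_stem u (slice_dom \<Omega>)"
      and evW: "eventually (\<lambda>z. z \<in> slice_dom W) (cosparse (slice_dom \<Omega>))"
      and evu: "eventually (\<lambda>z. bvec (stem f z) * u z + u z * bvec (stem f z) = 1)
        (cosparse (slice_dom \<Omega>))"
      using anticommuting_inverse[OF assms(1,2)] .
    define V where "V = W \<inter> dom b"
    define S where "S z = u z * stem b z" for z
    have V: "open V" "circular V" "V \<subseteq> \<Omega>"
      using W SEM_D(2,3)[OF b] circular_Int by (auto simp: V_def)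
    have evV: "eventually (\<lambda>z. z \<in> slice_dom V) (cosparse (slice_dom \<Omega>))"
      using evW SEM_cosparse[OF b op] unfolding V_def slice_dom_Int by eventually_elim simp
    have sym: "symmetric_stem S"
      using u(1) symmetric_stem_of[of "\<lambda>q. the (b q)"] by (simp add: symmetric_stem_def S_def)
    have hol: "holomorphic_stem S (slice_dom V)"
      unfolding S_def using u(2) sb
      by (intro holomorphic_stem_mult)
        (auto simp: V_def slice_dom_Int stem_fun_def elim!: holomorphic_stem_subset)
    have mer: "meromorphic_stem S (slice_dom \<Omega>)"
      unfolding S_def by (intro meromorphic_stem_mult u(3) SEM_meromorphic_stem[OF b])
    have "eventually (\<lambda>z. stem f z * S z + S z * stem g z = stem b z) (cosparse (slice_dom \<Omega>))"
      using cond re evu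
    proof eventually_elim
      case (elim z)
      from sylvester_sufficient[OF elim(2,1,3)] show ?case
        by (simp add: S_def)
    qed
    then have "f \<star> induced_pfun V S +\<^sub>s induced_pfun V S \<star> g =\<^sub>s b"
      using eqn_iff[OF stem_fun_induced_pfun[OF V sym hol evV]] by simp
    moreover have "induced_pfun V S \<in> SEM \<Omega>"
      using induced_pfun_SEM[OF op circ V sym hol mer evV] .
    ultimately show "\<exists>X \<in> SEM \<Omega>. f \<star> X +\<^sub>s X \<star> g =\<^sub>s b"
      by blast
  qed
qed

end
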